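(* Let $\Phi=(A;\{E_i\}_{i=0}^d;A^*;\{E^*_i\}_{i=0}^d)$ be a Leonard system in $\mathcal{A}$ with parameter array $(\{\theta_i\}_{i=0}^d;\{\theta^*_i\}_{i=0}^d;\{\varphi_i\}_{i=1}^d;\{\phi_i\}_{i=1}^d)$, and let $\xi_0\in E_0V$, $\xi_d\in E_dV$, $\xi^*_0\in E^*_0V$, $\xi^*_d\in E^*_dV$ be nonzero vectors. Then (i) and (ii) hold. (i) Let $\{X_i\}_{i=0}^d$ denote one of the sequences $\{E_i\}_{i=0}^d$, $\{E_{d-i}\}_{i=0}^d$, $\{\tau_i(A)\}_{i=0}^d$, $\{\tau_{d-i}(A)\}_{i=0}^d$, $\{\eta_i(A)\}_{i=0}^d$, $\{\eta_{d-i}(A)\}_{i=0}^d$. Then for $0\le i\le d$, \begin{align*} \frac{\langle\xi^*_0,\xi^*_0\rangle}{\langle\xi_0,\xi^*_0\rangle}\sum_{r=0}^d\frac{X_rE^*_0E_0E^*_r}{\mathrm{tr}(E^*_rE_0)}\cdot E^*_i\xi_0 &= X_i\xi^*_0,\\ \frac{\langle\xi^*_d,\xi^*_d\rangle}{\langle\xi_0,\xi^*_d\rangle}\sum_{r=0}^d\frac{X_rE^*_dE_0E^*_r}{\mathrm{tr}(E^*_rE_0)}\cdot E^*_i\xi_0 &= X_i\xi^*_d,\\ \frac{\langle\xi^*_0,\xi^*_0\rangle}{\langle\xi_0,\xi^*_0\rangle}\sum_{r=0}^d\frac{X_{d-r}E^*_0E_0E^*_r}{\mathrm{tr}(E^*_rE_0)}\cdot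 E^*_{d-i}\xi_0 &= X_i\xi^*_0,\\ \frac{\langle\xi^*_d,\xi^*_d\rangle}{\langle\xi_0,\xi^*_d\rangle}\sum_{r=0}^d\frac{X_{d-r}E^*_dE_0E^*_r}{\mathrm{tr}(E^*_rE_0)}\cdot E^*_{d-i}\xi_0 &= X_i\xi^*_d. \end{align*} (ii) Let $\{X_i\}_{i=0}^d$ denote one of the sequences $\{E^*_i\}_{i=0}^d$, $\{E^*_{d-i}\}_{i=0}^d$, $\{\tau^*_i(A^* )\}_{i=0}^d$, $\{\tau^*_{d-i}(A^* )\}_{i=0}^d$, $\{\eta^*_i(A^* )\}_{i=0}^d$, $\{\eta^*_{d-i}(A^* )\}_{i=0}^d$. Then for $0\le i\le d$, \begin{align*} \sum_{r=0}^d\frac{X_rE_0E^*_r}{\mathrm{tr}(E^*_rE_0)}\cdot E^*_i\xi_0 &= X_i\xi_0,\\ \frac{\tau_d(\theta_d)}{\phi}\frac{\langle\xi_d,\xi^*_d\rangle}{\langle\xi_0,\xi^*_d\rangle}\sum_{r=0}^d\tau^*_r(\theta^*_r)\eta^*_{d-r}(\theta^*_r)X_rE_dE^*_r\cdot E^*_i\xi_0 &= X_i\xi_d,\\ \sum_{r=0}^d\frac{X_{d-r}E_0E^*_r}{\mathrm{tr}(E^*_rE_0)}\cdot E^*_{d-i}\xi_0 &= X_i\xi_0,\\ \frac{\tau_d(\theta_d)}{\phi}\frac{\langle\xi_d,\xi^*_d\rangle}{\langle\xi_0,\xi^*_d\rangle}\sum_{r=0}^d\tau^*_r(\theta^*_r)\eta^*_{d-r}(\theta^*_r)X_{d-r}E_dE^*_r\cdot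 E^*_{d-i}\xi_0 &= X_i\xi_d. \end{align*}
   Context: Let $\mathbb{K}$ be a field, $d\ge 0$ an integer, $\mathcal{A}$ a $\mathbb{K}$-algebra isomorphic to the algebra $\mathrm{Mat}_{d+1}(\mathbb{K})$ of all $(d+1)\times(d+1)$ matrices over $\mathbb{K}$, $I$ its identity, and $V$ an irreducible left $\mathcal{A}$-module (so $\dim V=d+1$). For $X\in\mathcal{A}$, $\mathrm{tr}(X)$ is the trace of $X$ (equivalently of its action on $V$). Leonard system. An element of $\mathcal{A}$ is multiplicity-free if it has $d+1$ mutually distinct eigenvalues in $\mathbb{K}$. If $A$ is multiplicity-free with eigenvalues $\theta_0,\dots,\theta_d$, the primitive idempotent of $A$ associated with $\theta_i$ is $E_i=\prod_{0\le j\le d,\,j\ne i}\frac{A-\theta_jI}{\theta_i-\theta_j}$ (the projection onto the one-dimensional $\theta_i$-eigenspace $E_iV$). A Leonard system in $\mathcal{A}$ is a sequence $\Phi=(A;\{E_i\}_{i=0}^d;A^*;\{E^*_i\}_{i=0}^d)$ such that: (i) each of $A,A^*$ is a multiplicity-free element of $\mathcal{A}$ ($A^*$ is just another element; no adjoint is meant); (ii) $\{E_i\}_{i=0}^d$ is an ordering of the primitive idempotents of $A$; (iii) $\{E^*_i\}_{i=0}^d$ is an ordering of the primitive idempotents of $A^*$; (iv) for $0\le i,j\le d$, $E_iA^*E_j=0$ if $|i-j|>1$ and $E_iA^*E_j\ne0$ if $|i-j|=1$; (v) for $0\le i,j\le d$, $E^*_iAE^*_j=0$ if $|i-j|>1$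 and $E^*_iAE^*_j\neq0$ if $|i-j|=1$. Parameter array. $\theta_i$ (resp. $\theta^*_i$) is the eigenvalue of $A$ (resp. $A^*$) associated with $E_i$ (resp. $E^*_i$). For $0\le i\le d$ define polynomials $\tau_i=(\lambda-\theta_0)(\lambda-\theta_1)\cdots(\lambda-\theta_{i-1})$, $\eta_i=(\lambda-\theta_d)(\lambda-\theta_{d-1})\cdots(\lambda-\theta_{d-i+1})$, $\tau^*_i=(\lambda-\theta^*_0)(\lambda-\theta^*_1)\cdots(\lambda-\theta^*_{i-1})$, $\eta^*_i=(\lambda-\theta^*_d)(\lambda-\theta^*_{d-1})\cdots(\lambda-\theta^*_{d-i+1})$. For $1\le i\le d$ define $\varphi_i=(\theta^*_0-\theta^*_i)\frac{\mathrm{tr}(\tau_i(A)E^*_0)}{\mathrm{tr}(\tau_{i-1}(A)E^*_0)}$ and $\phi_i=(\theta^*_0-\theta^*_i)\frac{\mathrm{tr}(\eta_i(A)E^*_0)}{\mathrm{tr}(\eta_{i-1}(A)E^*_0)}$; the denominators, and all $\varphi_i,\phi_i$, are known to be nonzero. The parameter array of $\Phi$ is $(\{\theta_i\}_{i=0}^d;\{\theta^*_i\}_{i=0}^d;\{\varphi_i\}_{i=1}^d;\{\phi_i\}_{i=1}^d)$. Abbreviate $\varphi=\varphi_1\varphi_2\cdots\varphi_d$ and $\phi=\phi_1\phi_2\cdots\phi_d$. Empty products are $1$. Bilinear form. There is a unique antiautomorphism $\dagger$ of $\mathcal{A}$ ($\mathbb{K}$-linear bijection with $(XY)^\dagger=Y^\dagger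 X^\dagger$) with $A^\dagger=A$ and $A^{*\dagger}=A^*$. $\langle\,,\rangle$ denotes a fixed nonzero bilinear form on $V$ with $\langle Xu,v\rangle=\langle u,X^\dagger v\rangle$ for all $X\in\mathcal{A}$, $u,v\in V$; it exists, is unique up to a nonzero scalar factor, and is nondegenerate and symmetric. All scalars appearing in denominators (traces and inner products) are known to be nonzero. The notation $T\cdot v$ means the element $T\in\mathcal{A}$ (including the scalar prefactor and the whole sum) applied to $v\in V$. *)

theory Defs
  imports
    "HOL-Computational_Algebra.Polynomial"
    "Jordan_Normal_Form.Matrix"
begin

text \<open>Scalar multiplications are explicit parameters because the base field is arbitrary.\<close>

locale field_algebra = Vector_Spaces.vector_space scale
  for scale :: "'k::field \<Rightarrow> 'a::ring_1 \<Rightarrow> 'a" +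
  assumes scale_mult_left: "scale c x * y = scale c (x * y)"
    and scale_mult_right: "x * scale c y = scale c (x * y)"

locale matrix_algebra = field_algebra scale
  for scale :: "'k::field \<Rightarrow> 'a::ring_1 \<Rightarrow> 'a" +
  fixes d :: nat and rep :: "'a \<Rightarrow> 'k mat"
  assumes rep_bij: "bij_betw rep UNIV (carrier_mat (Suc d) (Suc d))"
    and rep_add: "rep (x + y) = rep x + rep y"
    and rep_scale: "rep (scale c x) = c \<cdot>\<^sub>m rep x"
    and rep_mult: "rep (x * y) = rep x * rep y"
    and rep_one: "rep 1 = 1\<^sub>m (Suc d)"

locale algebra_module =
  alg: field_algebra scaleA + V: Vector_Spaces.vector_space scaleV
  for scaleA :: "'k::field \<Rightarrow> 'a::ring_1 \<Rightarrow> 'a"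
    and scaleV :: "'k \<Rightarrow> 'v::ab_group_add \<Rightarrow> 'v" +
  fixes act :: "'a \<Rightarrow> 'v \<Rightarrow> 'v"
  assumes act_add_left: "act (x + y) v = act x v + act y v"
    and act_add_right: "act x (v + w) = act x v + act x w"
    and act_mult: "act (x * y) v = act x (act y v)"
    and act_one: "act 1 v = v"
    and act_scale: "act (scaleA c x) v = scaleV c (act x v)"

locale irreducible_algebra_module = algebra_module scaleA scaleV act
  for scaleA :: "'k::field \<Rightarrow> 'a::ring_1 \<Rightarrow> 'a"
    and scaleV :: "'k \<Rightarrow> 'v::ab_group_add \<Rightarrow> 'v"
    and act :: "'a \<Rightarrow> 'v \<Rightarrow> 'v" +
  assumes nontrivial: "\<exists>v::'v. v \<noteq> 0"
    and irreducible:
      "V.subspace W \<Longrightarrow> (\<And>x w. w \<in> W \<Longrightarrow> act x w \<in> W) \<Longrightarrow> W = {0} \<or> W = UNIV"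

definition mat_trace :: "'k::comm_monoid_add mat \<Rightarrow> 'k" where
  "mat_trace M = (\<Sum>i<dim_row M. M $$ (i, i))"

text \<open>By the Skolem--Noether theorem the following does not depend on the choice of the
  isomorphism \<open>rep\<close> onto the full matrix algebra.\<close>

definition alg_trace :: "('a \<Rightarrow> 'k::comm_monoid_add mat) \<Rightarrow> 'a \<Rightarrow> 'k" where
  "alg_trace rep x = mat_trace (rep x)"

definition alg_poly :: "('k::field \<Rightarrow> 'a::ring_1 \<Rightarrow> 'a) \<Rightarrow> 'k poly \<Rightarrow> 'a \<Rightarrow> 'a" where
  "alg_poly scaleA p x = (\<Sum>k\<le>degree p. scaleA (poly.coeff p k) (x ^ k))"

definition eigenvalues ::
  "('k::field \<Rightarrow> 'v::ab_group_add \<Rightarrow> 'v) \<Rightarrow> ('a \<Rightarrow> 'v \<Rightarrow> 'v) \<Rightarrow> 'a \<Rightarrow> 'k set" where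
  "eigenvalues scaleV act x = {c. \<exists>v. v \<noteq> 0 \<and> act x v = scaleV c v}"

text \<open>\<open>card\<close> is \<open>0\<close> on infinite sets, so finiteness of the set of eigenvalues is implied.\<close>

definition multiplicity_free ::
  "nat \<Rightarrow> ('k::field \<Rightarrow> 'v::ab_group_add \<Rightarrow> 'v) \<Rightarrow> ('a \<Rightarrow> 'v \<Rightarrow> 'v) \<Rightarrow> 'a \<Rightarrow> bool" where
  "multiplicity_free d scaleV act x \<longleftrightarrow> card (eigenvalues scaleV act x) = Suc d"

text \<open>The factors commute; a list product is used only because \<open>'a\<close> is noncommutative.\<close>

definition primitive_idempotent ::
  "nat \<Rightarrow> ('k::field \<Rightarrow> 'a::ring_1 \<Rightarrow> 'a) \<Rightarrow> 'a \<Rightarrow> (nat \<Rightarrow> 'k) \<Rightarrow> nat \<Rightarrow> 'a" where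
  "primitive_idempotent d scaleA x \<theta> i =
     prod_list (map (\<lambda>j. scaleA (1 / (\<theta> i - \<theta> j)) (x - scaleA (\<theta> j) 1))
                    (filter (\<lambda>j. j \<noteq> i) [0..<Suc d]))"

text \<open>\<open>E\<^sub>0, \<dots>, E\<^sub>d\<close> is an ordering of the primitive idempotents of \<open>x\<close>, and \<open>\<theta>\<^sub>i\<close> is the
  eigenvalue associated with \<open>E\<^sub>i\<close>. Sequences indexed by \<open>0, \<dots>, d\<close> are functions on \<open>nat\<close> whose
  values beyond \<open>d\<close> are irrelevant.\<close>

definition idempotents_with_eigenvalues ::
  "nat \<Rightarrow> ('k::field \<Rightarrow> 'a::ring_1 \<Rightarrow> 'a) \<Rightarrow> ('k \<Rightarrow> 'v::ab_group_add \<Rightarrow> 'v) \<Rightarrow> ('a \<Rightarrow> 'v \<Rightarrow> 'v) \<Rightarrow>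
   'a \<Rightarrow> (nat \<Rightarrow> 'a) \<Rightarrow> (nat \<Rightarrow> 'k) \<Rightarrow> bool" where
  "idempotents_with_eigenvalues d scaleA scaleV act x E \<theta> \<longleftrightarrow>
     bij_betw \<theta> {..d} (eigenvalues scaleV act x) \<and>
     (\<forall>i\<le>d. E i = primitive_idempotent d scaleA x \<theta> i)"

definition leonard_system ::
  "nat \<Rightarrow> ('k::field \<Rightarrow> 'a::ring_1 \<Rightarrow> 'a) \<Rightarrow> ('k \<Rightarrow> 'v::ab_group_add \<Rightarrow> 'v) \<Rightarrow> ('a \<Rightarrow> 'v \<Rightarrow> 'v) \<Rightarrow>
   'a \<Rightarrow> (nat \<Rightarrow> 'a) \<Rightarrow> 'a \<Rightarrow> (nat \<Rightarrow> 'a) \<Rightarrow> bool" where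
  "leonard_system d scaleA scaleV act A E As Es \<longleftrightarrow>
     multiplicity_free d scaleV act A \<and>
     multiplicity_free d scaleV act As \<and>
     (\<exists>\<theta>. idempotents_with_eigenvalues d scaleA scaleV act A E \<theta>) \<and>
     (\<exists>\<theta>s. idempotents_with_eigenvalues d scaleA scaleV act As Es \<theta>s) \<and>
     (\<forall>i\<le>d. \<forall>j\<le>d.
        (\<bar>int i - int j\<bar> > 1 \<longrightarrow> E i * As * E j = 0) \<and>
        (\<bar>int i - int j\<bar> = 1 \<longrightarrow> E i * As * E j \<noteq> 0)) \<and>
     (\<forall>i\<le>d. \<forall>j\<le>d.
        (\<bar>int i - int j\<bar> > 1 \<longrightarrow> Es i * A * Es j = 0) \<and>
        (\<bar>int i - int j\<bar> = 1 \<longrightarrow> Es i * A * Es j \<noteq> 0))"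

definition tau :: "(nat \<Rightarrow> 'k::field) \<Rightarrow> nat \<Rightarrow> 'k poly" where
  "tau \<theta> i = (\<Prod>j<i. [:- \<theta> j, 1:])"

definition eta :: "nat \<Rightarrow> (nat \<Rightarrow> 'k::field) \<Rightarrow> nat \<Rightarrow> 'k poly" where
  "eta d \<theta> i = (\<Prod>j<i. [:- \<theta> (d - j), 1:])"

text \<open>\<open>vphi\<close> and \<open>phi\<close> are the first and the second split sequence.\<close>

definition parameter_array ::
  "nat \<Rightarrow> ('k::field \<Rightarrow> 'a::ring_1 \<Rightarrow> 'a) \<Rightarrow> ('a \<Rightarrow> 'k mat) \<Rightarrow>
   ('k \<Rightarrow> 'v::ab_group_add \<Rightarrow> 'v) \<Rightarrow> ('a \<Rightarrow> 'v \<Rightarrow> 'v) \<Rightarrow>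
   'a \<Rightarrow> (nat \<Rightarrow> 'a) \<Rightarrow> 'a \<Rightarrow> (nat \<Rightarrow> 'a) \<Rightarrow>
   (nat \<Rightarrow> 'k) \<Rightarrow> (nat \<Rightarrow> 'k) \<Rightarrow> (nat \<Rightarrow> 'k) \<Rightarrow> (nat \<Rightarrow> 'k) \<Rightarrow> bool" where
  "parameter_array d scaleA rep scaleV act A E As Es \<theta> \<theta>s vphi phi \<longleftrightarrow>
     idempotents_with_eigenvalues d scaleA scaleV act A E \<theta> \<and>
     idempotents_with_eigenvalues d scaleA scaleV act As Es \<theta>s \<and>
     (\<forall>i\<in>{1..d}.
        vphi i = (\<theta>s 0 - \<theta>s i) *
          (alg_trace rep (alg_poly scaleA (tau \<theta> i) A * Es 0) /
           alg_trace rep (alg_poly scaleA (tau \<theta> (i - 1)) A * Es 0))) \<and>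
     (\<forall>i\<in>{1..d}.
        phi i = (\<theta>s 0 - \<theta>s i) *
          (alg_trace rep (alg_poly scaleA (eta d \<theta> i) A * Es 0) /
           alg_trace rep (alg_poly scaleA (eta d \<theta> (i - 1)) A * Es 0)))"

definition antiautomorphism ::
  "('k::field \<Rightarrow> 'a::ring_1 \<Rightarrow> 'a) \<Rightarrow> ('a \<Rightarrow> 'a) \<Rightarrow> bool" where
  "antiautomorphism scaleA f \<longleftrightarrow>
     Vector_Spaces.linear scaleA scaleA f \<and> bij f \<and> (\<forall>x y. f (x * y) = f y * f x)"

definition bilinear_form ::
  "('k::field \<Rightarrow> 'v::ab_group_add \<Rightarrow> 'v) \<Rightarrow> ('v \<Rightarrow> 'v \<Rightarrow> 'k) \<Rightarrow> bool" where
  "bilinear_form scaleV b \<longleftrightarrow>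
     (\<forall>v. Vector_Spaces.linear scaleV (*) (\<lambda>u. b u v)) \<and>
     (\<forall>u. Vector_Spaces.linear scaleV (*) (b u))"

end

theory Submission
  imports Defs
begin

text \<open>In each of the eight sums only one summand acts nontrivially, namely the one whose factor \<open>E\<^sup>*\<^sub>r\<close> also
  stands in front of \<open>\<xi>\<^sub>0\<close>. In this summand \<open>X\<^sub>i\<close> is the leftmost factor, and what it is applied to is
  determined by three identities between vectors:
  \<^item> \<open>E\<^sub>0 E\<^sup>*\<^sub>i \<xi>\<^sub>0 = tr(E\<^sup>*\<^sub>i E\<^sub>0) \<xi>\<^sub>0\<close>, which holds because \<open>E\<^sub>0\<close> is an idempotent of rank one
    (\<open>idempotent_trace\<close>);
  \<^item> \<open>E\<^sup>*\<^sub>l \<xi>\<^sub>0 = \<langle>\<xi>\<^sub>0, \<xi>\<^sup>*\<^sub>l\<rangle> / \<langle>\<xi>\<^sup>*\<^sub>l, \<xi>\<^sup>*\<^sub>l\<rangle> \<xi>\<^sup>*\<^sub>l\<close> for \<open>l = 0, d\<close>, which holds because \<open>E\<^sup>*\<^sub>l\<close> is self-adjoint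
    (\<open>form_projection\<close>);
  \<^item> the value of \<open>E\<^sub>d E\<^sup>*\<^sub>i \<xi>\<^sub>0\<close> as a multiple of \<open>\<xi>\<^sub>d\<close>.

  The third one rests on the tridiagonal relations. Write \<open>c\<^sup>*\<^sub>i = \<Prod>\<^sub>j\<^sub>\<noteq>\<^sub>i (\<theta>\<^sup>*\<^sub>i - \<theta>\<^sup>*\<^sub>j)\<close>, which is also
  \<open>\<tau>\<^sup>*\<^sub>i(\<theta>\<^sup>*\<^sub>i) \<eta>\<^sup>*\<^sub>d\<^sub>-\<^sub>i(\<theta>\<^sup>*\<^sub>i)\<close>. The element \<open>c\<^sup>*\<^sub>i E\<^sup>*\<^sub>i\<close> is a monic polynomial of degree \<open>d\<close> in \<open>A\<^sup>*\<close>, and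
  \<open>E\<^sub>d (A\<^sup>*)\<^sup>k E\<^sub>0\<close> vanishes for \<open>k < d\<close> but not for \<open>k = d\<close>; so \<open>c\<^sup>*\<^sub>i E\<^sub>d E\<^sup>*\<^sub>i E\<^sub>0 = E\<^sub>d (A\<^sup>*)\<^sup>d E\<^sub>0\<close> is nonzero
  and independent of \<open>i\<close> (\<open>corner\<close>). It can therefore be evaluated at \<open>i = d\<close>, where two orthogonal
  projections give \<open>c\<^sup>*\<^sub>d tr(E\<^sub>d E\<^sup>*\<^sub>d)\<close> up to the ratio of inner products in the claim.

  What remains is \<open>\<phi> = c\<^sub>d c\<^sup>*\<^sub>d tr(E\<^sub>d E\<^sup>*\<^sub>d)\<close>, with \<open>c\<^sub>d = \<tau>\<^sub>d(\<theta>\<^sub>d)\<close> (\<open>prod_split_sequence\<close>). The definition of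
  \<open>\<phi>\<^sub>i\<close> telescopes, once its denominators are known to be nonzero (\<open>eta_trace_nonzero\<close>), to
  \<open>\<phi> = c\<^sub>0 c\<^sup>*\<^sub>0 tr(E\<^sub>0 E\<^sup>*\<^sub>0)\<close>, and the corner identity together with its dual shows that the two ends give
  the same number (\<open>end_traces\<close>). The corner identity, combined with the nondegeneracy of the form,
  also yields that the traces and inner products in the denominators are nonzero.\<close>

section \<open>Polynomials in an algebra element\<close>

context field_algebra
begin

lemma alg_poly_eq_sum:
  assumes "degree p \<le> n"
  shows "alg_poly scale p x = (\<Sum>k\<le>n. scale (poly.coeff p k) (x ^ k))"
  unfolding alg_poly_def
  by (rule sum.mono_neutral_left) (use assms in \<open>auto simp: coeff_eq_0\<close>)

lemma alg_poly_0 [simp]: "alg_poly scale 0 x = 0"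
  by (simp add: alg_poly_def)

lemma alg_poly_pCons: "alg_poly scale (pCons a p) x = scale a 1 + x * alg_poly scale p x"
proof -
  have "alg_poly scale (pCons a p) x = (\<Sum>k\<le>Suc (degree p). scale (poly.coeff (pCons a p) k) (x ^ k))"
    by (rule alg_poly_eq_sum) (simp add: degree_pCons_le)
  also have "\<dots> = scale a 1 + (\<Sum>k\<le>degree p. x * scale (poly.coeff p k) (x ^ k))"
    by (simp add: sum.atMost_Suc_shift scale_mult_right del: sum.atMost_Suc)
  finally show ?thesis
    by (simp add: alg_poly_def sum_distrib_left)
qed

lemma alg_poly_1 [simp]: "alg_poly scale 1 x = 1"
  by (simp add: alg_poly_pCons one_pCons)

lemma alg_poly_add: "alg_poly scale (p + q) x = alg_poly scale p x + alg_poly scale q x"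
  by (induction p q rule: poly_induct2) (simp_all add: alg_poly_pCons algebra_simps scale_left_distrib)

lemma alg_poly_smult: "alg_poly scale (Polynomial.smult c p) x = scale c (alg_poly scale p x)"
  by (induction p) (simp_all add: alg_poly_pCons scale_right_distrib scale_mult_right)

lemma alg_poly_mult: "alg_poly scale (p * q) x = alg_poly scale p x * alg_poly scale q x"
  by (induction p)
    (simp_all add: alg_poly_pCons alg_poly_add alg_poly_smult distrib_right scale_mult_left mult.assoc)

lemma alg_poly_prod_list:
  "alg_poly scale (prod_list (map f js)) x = prod_list (map (\<lambda>j. alg_poly scale (f j) x) js)"
  by (induction js) (simp_all add: alg_poly_mult)

text \<open>Powers of one element commute with each other, so the reversal of products cannot be seen on
  polynomials in it. In particular the antiautomorphism that fixes \<open>A\<close> also fixes the primitive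
  idempotents of \<open>A\<close>, which makes each of them self-adjoint for the bilinear form.\<close>

lemma antiautomorphism_alg_poly:
  assumes "antiautomorphism scale dag"
  shows "dag (alg_poly scale p x) = alg_poly scale p (dag x)"
proof -
  from assms have lin: "Vector_Spaces.linear scale scale dag" and bij: "bij dag"
    and mult: "dag (u * v) = dag v * dag u" for u v
    by (auto simp: antiautomorphism_def)
  interpret dag: Vector_Spaces.linear scale scale dag by (rule lin)
  obtain y where y: "dag y = 1"
    using bij by (metis bij_pointE)
  have dag_1: "dag 1 = 1"
    using mult[of 1 y] y by simp
  have "dag (x ^ k) = dag x ^ k" for k
    by (induction k) (simp_all add: dag_1 mult power_commutes)
  then show ?thesis
    by (simp add: alg_poly_def dag.sum dag.scale)
qed

end

section \<open>The irreducible module of a matrix algebra\<close>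

lemma (in algebra_module) act_scale_right: "act x (scaleV c v) = scaleV c (act x v)"
proof -
  have "act x (scaleV c v) = act (x * scaleA c 1) v"
    by (simp add: act_mult act_scale act_one)
  also have "\<dots> = scaleV c (act x v)"
    by (simp add: alg.scale_mult_right act_scale)
  finally show ?thesis .
qed

context algebra_module
begin

lemma act_zero_left [simp]: "act 0 v = 0"
  using act_add_left[of 0 0 v] by simp

lemma act_zero_right [simp]: "act x 0 = 0"
  using act_add_right[of x 0 0] by simp

lemma act_sum_left: "act (\<Sum>i\<in>S. f i) v = (\<Sum>i\<in>S. act (f i) v)"
  by (induction S rule: infinite_finite_induct) (simp_all add: act_add_left)

lemma act_sum_right: "act x (\<Sum>i\<in>S. f i) = (\<Sum>i\<in>S. act x (f i))"
  by (induction S rule: infinite_finite_induct) (simp_all add: act_add_right)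

lemma act_alg_poly_eigenvector:
  assumes "act x v = scaleV c v"
  shows "act (alg_poly scaleA p x) v = scaleV (poly p c) v"
  by (induction p)
    (simp_all add: assms alg.alg_poly_pCons act_add_left act_mult act_scale act_one act_scale_right
       V.scale_left_distrib mult.commute)

end

context matrix_algebra
begin

definition entry :: "'a \<Rightarrow> nat \<Rightarrow> nat \<Rightarrow> 'k" where
  "entry x i j = rep x $$ (i, j)"

lemma rep_carrier [simp]: "rep x \<in> carrier_mat (Suc d) (Suc d)"
  using rep_bij by (auto simp: bij_betw_def)

lemma rep_dim [simp]: "dim_row (rep x) = Suc d" "dim_col (rep x) = Suc d"
  using rep_carrier[of x] by (blast dest: carrier_matD)+

lemma eq_if_entries_eq:
  assumes "\<And>i j. i \<le> d \<Longrightarrow> j \<le> d \<Longrightarrow> entry x i j = entry y i j"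
  shows "x = y"
proof -
  have "rep x = rep y"
    using assms by (intro eq_matI) (auto simp: entry_def)
  then show ?thesis
    using rep_bij by (auto simp: bij_betw_def inj_on_def)
qed

lemma entry_scale: "i \<le> d \<Longrightarrow> j \<le> d \<Longrightarrow> entry (scale c x) i j = c * entry x i j"
  by (simp add: entry_def rep_scale)

lemma entry_add: "i \<le> d \<Longrightarrow> j \<le> d \<Longrightarrow> entry (x + y) i j = entry x i j + entry y i j"
  by (simp add: entry_def rep_add)

lemma entry_0: "i \<le> d \<Longrightarrow> j \<le> d \<Longrightarrow> entry 0 i j = 0"
  using entry_scale[of i j 0 0] by simp

lemma entry_1: "i \<le> d \<Longrightarrow> j \<le> d \<Longrightarrow> entry 1 i j = (if i = j then 1 else 0)"
  by (simp add: entry_def rep_one)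

lemma entry_sum:
  "i \<le> d \<Longrightarrow> j \<le> d \<Longrightarrow> entry (\<Sum>s\<in>S. f s) i j = (\<Sum>s\<in>S. entry (f s) i j)"
  by (induction S rule: infinite_finite_induct) (simp_all add: entry_add entry_0)

lemma entry_mult:
  "i \<le> d \<Longrightarrow> j \<le> d \<Longrightarrow> entry (x * y) i j = (\<Sum>k\<le>d. entry x i k * entry y k j)"
  by (simp add: entry_def rep_mult scalar_prod_def lessThan_Suc_atMost[symmetric] atLeast0LessThan)

lemma alg_trace_eq: "alg_trace rep x = (\<Sum>i\<le>d. entry x i i)"
  by (simp add: alg_trace_def mat_trace_def entry_def lessThan_Suc_atMost)

lemma alg_trace_scale: "alg_trace rep (scale c x) = c * alg_trace rep x"
  by (simp add: alg_trace_eq entry_scale sum_distrib_left)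

lemma alg_trace_commute: "alg_trace rep (x * y) = alg_trace rep (y * x)"
  unfolding alg_trace_eq
  by (simp add: entry_mult mult.commute) (rule sum.swap)

definition matrix_unit :: "nat \<Rightarrow> nat \<Rightarrow> 'a" where
  "matrix_unit i j =
     inv_into UNIV rep (mat (Suc d) (Suc d) (\<lambda>(k, l). if k = i \<and> l = j then 1 else 0))"

lemma entry_matrix_unit:
  "k \<le> d \<Longrightarrow> l \<le> d \<Longrightarrow> entry (matrix_unit i j) k l = (if k = i \<and> l = j then 1 else 0)"
proof -
  assume kl: "k \<le> d" "l \<le> d"
  have "mat (Suc d) (Suc d) (\<lambda>(k, l). if k = i \<and> l = j then 1 else 0 :: 'k) \<in> rep ` UNIV"
    using rep_bij unfolding bij_betw_def by auto
  then have "rep (matrix_unit i j) = mat (Suc d) (Suc d) (\<lambda>(k, l). if k = i \<and> l = j then 1 else 0)"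
    unfolding matrix_unit_def by (rule f_inv_into_f)
  then show ?thesis
    using kl by (simp add: entry_def)
qed

lemma sum_matrix_unit_diagonal: "(\<Sum>i\<le>d. matrix_unit i i) = 1"
  by (rule eq_if_entries_eq) (auto simp: entry_sum entry_matrix_unit entry_1 intro!: sum.neutral)

lemma mult_matrix_unit:
  assumes "j \<le> d"
  shows "x * matrix_unit j k = (\<Sum>i\<le>d. scale (entry x i j) (matrix_unit i k))"
proof (rule eq_if_entries_eq)
  fix a b assume ab: "a \<le> d" "b \<le> d"
  have "(\<Sum>m\<le>d. entry x a m * (if m = j \<and> b = k then 1 else 0)) =
        (\<Sum>m\<le>d. if m = j then entry x a j * (if b = k then 1 else 0) else 0)"
    by (rule sum.cong) auto
  also have "\<dots> = (\<Sum>i\<le>d. if i = a then entry x a j * (if b = k then 1 else 0) else 0)"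
    using assms ab by simp
  also have "\<dots> = (\<Sum>i\<le>d. entry x i j * (if a = i \<and> b = k then 1 else 0))"
    by (rule sum.cong) auto
  finally show "entry (x * matrix_unit j k) a b =
      entry (\<Sum>i\<le>d. scale (entry x i j) (matrix_unit i k)) a b"
    using ab by (simp add: entry_mult entry_sum entry_scale entry_matrix_unit)
qed

end

text \<open>Irreducibility makes the module a copy of the space of column vectors, on which the matrix units
  can be used to read off faithfulness, the dimension, and the trace of the matrix \<open>rep x\<close>.\<close>

locale matrix_module =
  matrix_algebra scaleA d rep + irreducible_algebra_module scaleA scaleV act
  for scaleA :: "'k::field \<Rightarrow> 'a::ring_1 \<Rightarrow> 'a"
    and d :: nat
    and rep :: "'a \<Rightarrow> 'k mat"
    and scaleV :: "'k \<Rightarrow> 'v::ab_group_add \<Rightarrow> 'v"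
    and act :: "'a \<Rightarrow> 'v \<Rightarrow> 'v"
begin

text \<open>Some diagonal matrix unit \<open>e\<^sub>k\<^sub>k\<close> does not annihilate a given nonzero vector \<open>u\<close>, because these units add up
  to \<open>1\<close>. The vectors \<open>v\<^sub>j = e\<^sub>j\<^sub>k u\<close> then transform like the columns of the matrix of \<open>x\<close>. They are
  independent because \<open>e\<^sub>k\<^sub>m\<close> extracts the coefficient of \<open>v\<^sub>m\<close>, and they span because their span
  is a nonzero submodule.\<close>

lemma adapted_basis:
  obtains v where
    "\<And>x j. j \<le> d \<Longrightarrow> act x (v j) = (\<Sum>i\<le>d. scaleV (entry x i j) (v i))"
    "\<And>c m. (\<Sum>i\<le>d. scaleV (c i) (v i)) = 0 \<Longrightarrow> m \<le> d \<Longrightarrow> c m = 0"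
    "\<And>u. \<exists>c. u = (\<Sum>i\<le>d. scaleV (c i) (v i))"
proof -
  obtain u :: 'v where u: "u \<noteq> 0"
    using nontrivial by blast
  have "(\<Sum>i\<le>d. act (matrix_unit i i) u) = u"
    by (simp flip: act_sum_left add: sum_matrix_unit_diagonal act_one)
  then obtain k where k: "k \<le> d" "act (matrix_unit k k) u \<noteq> 0"
    using u by (metis (mono_tags, lifting) atMost_iff sum.neutral)
  define v where "v j = act (matrix_unit j k) u" for j
  have act_v: "act x (v j) = (\<Sum>i\<le>d. scaleV (entry x i j) (v i))" if "j \<le> d" for x j
    by (simp add: v_def mult_matrix_unit[OF that] act_sum_left act_scale flip: act_mult)
  have unit_v: "act (matrix_unit k m) (v j) = (if j = m then v k else 0)" if "j \<le> d" for m j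
  proof -
    have "(\<Sum>i\<le>d. scaleV (entry (matrix_unit k m) i j) (v i)) =
          (\<Sum>i\<le>d. if i = k then (if j = m then v k else 0) else 0)"
      by (rule sum.cong) (use that in \<open>auto simp: entry_matrix_unit\<close>)
    then show ?thesis
      using k by (simp add: act_v[OF that])
  qed
  have coeff_eq_0: "c m = 0" if "(\<Sum>i\<le>d. scaleV (c i) (v i)) = 0" "m \<le> d" for c m
  proof -
    have "0 = act (matrix_unit k m) (\<Sum>i\<le>d. scaleV (c i) (v i))"
      using that by simp
    also have "\<dots> = (\<Sum>i\<le>d. if i = m then scaleV (c m) (v k) else 0)"
      unfolding act_sum_right by (rule sum.cong) (auto simp: act_scale_right unit_v)
    also have "\<dots> = scaleV (c m) (v k)"
      using that by simp
    finally show ?thesis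
      using k by (simp add: v_def)
  qed
  define W where "W = range (\<lambda>c. \<Sum>i\<le>d. scaleV (c i) (v i))"
  have W_I: "(\<Sum>i\<le>d. scaleV (c i) (v i)) \<in> W" for c
    by (auto simp: W_def)
  have W: "W = {0} \<or> W = UNIV"
  proof (rule irreducible)
    show "V.subspace W"
    proof (rule V.subspaceI)
      show "0 \<in> W"
        using W_I[of "\<lambda>_. 0"] by simp
    next
      fix x y assume "x \<in> W" "y \<in> W"
      then obtain c c' where
        "x = (\<Sum>i\<le>d. scaleV (c i) (v i))" "y = (\<Sum>i\<le>d. scaleV (c' i) (v i))"
        by (auto simp: W_def)
      then show "x + y \<in> W"
        using W_I[of "\<lambda>i. c i + c' i"] by (simp add: V.scale_left_distrib sum.distrib)
    next
      fix a x assume "x \<in> W"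
      then obtain c where "x = (\<Sum>i\<le>d. scaleV (c i) (v i))"
        by (auto simp: W_def)
      then show "scaleV a x \<in> W"
        using W_I[of "\<lambda>i. a * c i"] by (simp add: V.scale_sum_right)
    qed
  next
    fix x w assume "w \<in> W"
    then obtain c where "w = (\<Sum>i\<le>d. scaleV (c i) (v i))"
      by (auto simp: W_def)
    then have "act x w = (\<Sum>j\<le>d. \<Sum>i\<le>d. scaleV (c j * entry x i j) (v i))"
      by (simp add: act_sum_right act_scale_right act_v V.scale_sum_right)
    also have "\<dots> = (\<Sum>i\<le>d. scaleV (\<Sum>j\<le>d. c j * entry x i j) (v i))"
      by (subst sum.swap) (simp add: V.scale_sum_left)
    finally show "act x w \<in> W"
      using W_I by simp
  qed
  have "v k = (\<Sum>i\<le>d. scaleV (if i = k then 1 else 0) (v i))"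
    using k by (simp add: if_distrib[of "\<lambda>c. scaleV c _"] cong: if_cong)
  then have "v k \<in> W"
    using W_I by metis
  with W k have "W = UNIV"
    by (auto simp: v_def)
  then have "\<exists>c. u = (\<Sum>i\<le>d. scaleV (c i) (v i))" for u
    by (auto simp: W_def set_eq_iff image_iff)
  with that act_v coeff_eq_0 show thesis
    by blast
qed

lemma act_faithful:
  assumes "\<And>v. act x v = act y v"
  shows "x = y"
proof -
  obtain v where v: "\<And>x j. j \<le> d \<Longrightarrow> act x (v j) = (\<Sum>i\<le>d. scaleV (entry x i j) (v i))"
    and indep: "\<And>c m. (\<Sum>i\<le>d. scaleV (c i) (v i)) = 0 \<Longrightarrow> m \<le> d \<Longrightarrow> c m = 0"
    by (rule adapted_basis) blast
  show ?thesis
  proof (rule eq_if_entries_eq)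
    fix i j assume ij: "i \<le> d" "j \<le> d"
    have "(\<Sum>i\<le>d. scaleV (entry x i j - entry y i j) (v i)) = 0"
      using assms[of "v j"] ij by (simp add: v V.scale_left_diff_distrib sum_subtractf)
    from indep[OF this \<open>i \<le> d\<close>] show "entry x i j = entry y i j"
      by simp
  qed
qed

lemma nonzero_iff_act: "x \<noteq> 0 \<longleftrightarrow> (\<exists>v. act x v \<noteq> 0)"
  using act_faithful[of x 0] by auto

text \<open>In the adapted basis an element whose image lies in the line of \<open>w\<close> has a matrix of the form
  column times row. Its trace is the product row times column, which is the factor by which it
  scales \<open>w\<close>.\<close>

lemma alg_trace_rank_one:
  assumes range: "\<And>u. \<exists>c. act x u = scaleV c w"
    and w: "act x w = scaleV t w" "w \<noteq> 0"
  shows "alg_trace rep x = t"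
proof -
  obtain v where v: "\<And>x j. j \<le> d \<Longrightarrow> act x (v j) = (\<Sum>i\<le>d. scaleV (entry x i j) (v i))"
    and indep: "\<And>c m. (\<Sum>i\<le>d. scaleV (c i) (v i)) = 0 \<Longrightarrow> m \<le> d \<Longrightarrow> c m = 0"
    and spans: "\<And>u. \<exists>c. u = (\<Sum>i\<le>d. scaleV (c i) (v i))"
    by (rule adapted_basis) blast
  obtain f where f: "\<And>u. act x u = scaleV (f u) w"
    using range by metis
  obtain c where c: "w = (\<Sum>i\<le>d. scaleV (c i) (v i))"
    using spans by blast
  have entry: "entry x i j = f (v j) * c i" if "i \<le> d" "j \<le> d" for i j
  proof -
    have "scaleV (f (v j)) w = (\<Sum>i\<le>d. scaleV (f (v j) * c i) (v i))"
      by (subst c) (simp add: V.scale_sum_right)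
    then have "(\<Sum>i\<le>d. scaleV (entry x i j - f (v j) * c i) (v i)) = 0"
      using f[of "v j"] that by (simp add: v V.scale_left_diff_distrib sum_subtractf)
    from indep[OF this \<open>i \<le> d\<close>] show ?thesis
      by simp
  qed
  have "act x w = (\<Sum>j\<le>d. scaleV (c j) (scaleV (f (v j)) w))"
    by (subst (1) c) (simp add: act_sum_right act_scale_right f)
  also have "\<dots> = scaleV (\<Sum>j\<le>d. c j * f (v j)) w"
    by (simp add: V.scale_sum_left)
  finally have "t = (\<Sum>j\<le>d. c j * f (v j))"
    using w by simp
  then show ?thesis
    by (simp add: alg_trace_eq entry mult.commute)
qed

lemma dim_bound:
  assumes "V.independent S"
  shows "finite S \<and> card S \<le> Suc d"
proof -
  obtain v where spans: "\<And>u. \<exists>c. u = (\<Sum>i\<le>d. scaleV (c i) (v i))"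
    by (rule adapted_basis) blast
  have "S \<subseteq> V.span (v ` {..d})"
  proof
    fix u assume "u \<in> S"
    obtain c where "u = (\<Sum>i\<le>d. scaleV (c i) (v i))"
      using spans by blast
    then show "u \<in> V.span (v ` {..d})"
      by (auto intro!: V.span_sum V.span_scale intro: V.span_base)
  qed
  then have "finite S \<and> card S \<le> card (v ` {..d})"
    using assms by (intro V.independent_span_bound) auto
  moreover have "card (v ` {..d}) \<le> Suc d"
    using card_image_le[of "{..d}" v] by simp
  ultimately show ?thesis
    by simp
qed

end

section \<open>Products over the nodes of a spectrum\<close>

definition node_product :: "nat \<Rightarrow> (nat \<Rightarrow> 'k::field) \<Rightarrow> nat \<Rightarrow> 'k" where
  "node_product d \<theta> i = (\<Prod>j\<in>{..d} - {i}. \<theta> i - \<theta> j)"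

definition node_poly :: "nat \<Rightarrow> (nat \<Rightarrow> 'k::field) \<Rightarrow> nat \<Rightarrow> 'k poly" where
  "node_poly d \<theta> i = (\<Prod>j\<in>{..d} - {i}. [:- \<theta> j, 1:])"

lemma degree_prod_linear: "degree (\<Prod>j\<in>S. [:- f j, 1::'k::field:]) = card S"
  by (cases "finite S") (simp_all add: degree_prod_eq_sum_degree)

lemma lead_coeff_prod_linear: "lead_coeff (\<Prod>j\<in>S. [:- f j, 1::'k::field:]) = 1"
  by (simp add: lead_coeff_prod)

lemma degree_node_poly: "i \<le> d \<Longrightarrow> degree (node_poly d \<theta> i) = d"
  by (simp add: node_poly_def degree_prod_linear)

lemma lead_coeff_node_poly: "lead_coeff (node_poly d \<theta> i) = 1"
  by (simp add: node_poly_def lead_coeff_prod_linear)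

lemma poly_node_poly:
  assumes "i \<le> d" "j \<le> d"
  shows "poly (node_poly d \<theta> i) (\<theta> j) = (if j = i then node_product d \<theta> i else 0)"
  using assms by (auto simp: node_poly_def node_product_def poly_prod)

lemma eta_eq_prod:
  assumes "i \<le> Suc d"
  shows "eta d \<theta> i = (\<Prod>j\<in>{Suc d - i..d}. [:- \<theta> j, 1:])"
  unfolding eta_def
  by (rule prod.reindex_bij_witness[where i = "\<lambda>j. d - j" and j = "\<lambda>j. d - j"]) (use assms in auto)

text \<open>The factors \<open>\<tau>\<close> and \<open>\<eta>\<close> run through the nodes below and above \<open>r\<close>, so together they omit only
  \<open>r\<close> itself.\<close>

lemma tau_eta_eq_node_product:
  assumes "r \<le> d"
  shows "poly (tau \<theta> r) (\<theta> r) * poly (eta d \<theta> (d - r)) (\<theta> r) = node_product d \<theta> r"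
proof -
  have "{..d} - {r} = {..<r} \<union> {Suc d - (d - r)..d}"
    using assms by auto
  then have "node_product d \<theta> r = (\<Prod>j\<in>{..<r} \<union> {Suc d - (d - r)..d}. \<theta> r - \<theta> j)"
    by (simp add: node_product_def)
  also have "\<dots> = (\<Prod>j<r. \<theta> r - \<theta> j) * (\<Prod>j\<in>{Suc d - (d - r)..d}. \<theta> r - \<theta> j)"
    by (rule prod.union_disjoint) (use assms in auto)
  finally show ?thesis
    by (simp add: tau_def eta_eq_prod poly_prod)
qed

lemma tau_eq_node_product: "poly (tau \<theta> d) (\<theta> d) = node_product d \<theta> d"
  using tau_eta_eq_node_product[of d d \<theta>] by (simp add: eta_def)

lemma eta_eq_node_poly: "eta d \<theta> d = node_poly d \<theta> 0"
proof -
  have "{Suc d - d..d} = {..d} - {0}"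
    by auto
  then show ?thesis
    unfolding node_poly_def by (subst eta_eq_prod) simp_all
qed

section \<open>Primitive idempotents of a multiplicity-free element\<close>

locale multiplicity_free_element = matrix_module scaleA d rep scaleV act
  for scaleA :: "'k::field \<Rightarrow> 'a::ring_1 \<Rightarrow> 'a"
    and d :: nat
    and rep :: "'a \<Rightarrow> 'k mat"
    and scaleV :: "'k \<Rightarrow> 'v::ab_group_add \<Rightarrow> 'v"
    and act :: "'a \<Rightarrow> 'v \<Rightarrow> 'v" +
  fixes A :: 'a and E :: "nat \<Rightarrow> 'a" and \<theta> :: "nat \<Rightarrow> 'k"
  assumes idempotents: "idempotents_with_eigenvalues d scaleA scaleV act A E \<theta>"
begin

lemma eigenvalues_distinct: "i \<le> d \<Longrightarrow> j \<le> d \<Longrightarrow> \<theta> i = \<theta> j \<longleftrightarrow> i = j"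
  using idempotents
  by (auto simp: idempotents_with_eigenvalues_def bij_betw_def inj_on_def)

lemma node_product_nonzero: "i \<le> d \<Longrightarrow> node_product d \<theta> i \<noteq> 0"
  by (auto simp: node_product_def eigenvalues_distinct)

lemma idempotent_as_poly:
  assumes "i \<le> d"
  obtains p where "E i = alg_poly scaleA p A"
    "\<And>j. j \<le> d \<Longrightarrow> poly p (\<theta> j) = (if i = j then 1 else 0)"
proof
  define js where "js = filter (\<lambda>j. j \<noteq> i) [0..<Suc d]"
  let ?q = "\<lambda>j. Polynomial.smult (1 / (\<theta> i - \<theta> j)) [:- \<theta> j, 1:]"
  have js: "set js = {..d} - {i}"
    by (auto simp: js_def)
  have "alg_poly scaleA (?q j) A = scaleA (1 / (\<theta> i - \<theta> j)) (A - scaleA (\<theta> j) 1)" for j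
    by (simp only: alg_poly_smult) (simp add: alg_poly_pCons)
  then show "E i = alg_poly scaleA (prod_list (map ?q js)) A"
    using idempotents assms
    by (simp add: alg_poly_prod_list idempotents_with_eigenvalues_def primitive_idempotent_def js_def
        del: Polynomial.smult_pCons upt_Suc)
  show "poly (prod_list (map ?q js)) (\<theta> j) = (if i = j then 1 else 0)" if "j \<le> d" for j
  proof (cases "i = j")
    case True
    have "poly (?q l) (\<theta> i) = 1" if "l \<in> set js" for l
      using that assms by (auto simp: js eigenvalues_distinct simp del: Polynomial.smult_pCons)
    then have "poly (prod_list (map ?q js)) (\<theta> i) = 1"
      by (induction js) simp_all
    with True show ?thesis
      by simp
  next
    case False
    with that have "j \<in> set js"
      by (simp add: js)
    then have "poly (prod_list (map ?q js)) (\<theta> j) = 0"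
      by (induction js) auto
    with False show ?thesis
      by simp
  qed
qed

definition eigenvector :: "nat \<Rightarrow> 'v" where
  "eigenvector i = (SOME v. v \<noteq> 0 \<and> act A v = scaleV (\<theta> i) v)"

lemma eigenvector:
  assumes "i \<le> d"
  shows "eigenvector i \<noteq> 0" "act A (eigenvector i) = scaleV (\<theta> i) (eigenvector i)"
proof -
  have "\<theta> i \<in> eigenvalues scaleV act A"
    using idempotents assms by (auto simp: idempotents_with_eigenvalues_def bij_betw_def)
  then have "\<exists>v. v \<noteq> 0 \<and> act A v = scaleV (\<theta> i) v"
    by (simp add: eigenvalues_def)
  from someI_ex[OF this]
  show "eigenvector i \<noteq> 0" "act A (eigenvector i) = scaleV (\<theta> i) (eigenvector i)"
    by (simp_all add: eigenvector_def)
qed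

lemma act_poly_eigenvector:
  "i \<le> d \<Longrightarrow> act (alg_poly scaleA p A) (eigenvector i) = scaleV (poly p (\<theta> i)) (eigenvector i)"
  by (rule act_alg_poly_eigenvector) (rule eigenvector)

lemma act_idempotent_eigenvector:
  assumes "i \<le> d" "j \<le> d"
  shows "act (E i) (eigenvector j) = (if i = j then eigenvector j else 0)"
proof -
  obtain p where "E i = alg_poly scaleA p A" "poly p (\<theta> j) = (if i = j then 1 else 0)"
    using idempotent_as_poly assms by metis
  then show ?thesis
    using assms by (simp add: act_poly_eigenvector)
qed

text \<open>The primitive idempotents separate the chosen eigenvectors, which are therefore independent;
  there are \<open>d + 1\<close> of them, as many as the dimension allows. Hence an element of the algebra is
  determined by its values on them, and the usual identities between idempotents become evaluations
  of polynomials at the eigenvalues.\<close>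

lemma span_eigenvectors: "V.span (eigenvector ` {..d}) = UNIV"
proof -
  let ?W = "eigenvector ` {..d}"
  have inj: "inj_on eigenvector {..d}"
    by (rule inj_onI) (metis act_idempotent_eigenvector atMost_iff eigenvector(1))
  have indep: "V.independent ?W"
  proof
    assume "V.dependent ?W"
    then obtain c where c: "(\<Sum>v\<in>?W. scaleV (c v) v) = 0" and "\<exists>v\<in>?W. c v \<noteq> 0"
      by (subst (asm) V.dependent_finite) auto
    then obtain i where i: "i \<le> d" "c (eigenvector i) \<noteq> 0"
      by blast
    have "0 = act (E i) (\<Sum>j\<le>d. scaleV (c (eigenvector j)) (eigenvector j))"
      using c by (simp add: sum.reindex[OF inj])
    also have "\<dots> = (\<Sum>j\<le>d. if j = i then scaleV (c (eigenvector i)) (eigenvector i) else 0)"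
      unfolding act_sum_right
      by (rule sum.cong) (use i in \<open>auto simp: act_scale_right act_idempotent_eigenvector\<close>)
    also have "\<dots> = scaleV (c (eigenvector i)) (eigenvector i)"
      using i by simp
    finally show False
      using i eigenvector(1) by simp
  qed
  have "u \<in> V.span ?W" for u
  proof (rule ccontr)
    assume u: "u \<notin> V.span ?W"
    then have "V.independent (insert u ?W)"
      using indep by (simp add: V.independent_insert)
    from dim_bound[OF this] have "card (insert u ?W) \<le> Suc d"
      by simp
    moreover have "u \<notin> ?W"
      using u V.span_base[of u ?W] by auto
    ultimately show False
      by (simp add: card_image[OF inj])
  qed
  then show ?thesis
    by blast
qed

lemma eq_if_eq_on_eigenvectors:
  assumes "\<And>j. j \<le> d \<Longrightarrow> act x (eigenvector j) = act y (eigenvector j)"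
  shows "x = y"
proof (rule act_faithful)
  fix v
  have "V.span (eigenvector ` {..d}) \<subseteq> {v. act x v = act y v}"
  proof (rule V.span_minimal)
    show "V.subspace {v. act x v = act y v}"
      by (rule V.subspaceI) (simp_all add: act_add_right act_scale_right)
  qed (use assms in auto)
  then show "act x v = act y v"
    by (auto simp: span_eigenvectors)
qed

lemma idempotent_mult:
  "i \<le> d \<Longrightarrow> j \<le> d \<Longrightarrow> E i * E j = (if i = j then E i else 0)"
  by (rule eq_if_eq_on_eigenvectors) (auto simp: act_mult act_idempotent_eigenvector)

lemma alg_poly_expand: "alg_poly scaleA p A = (\<Sum>i\<le>d. scaleA (poly p (\<theta> i)) (E i))"
proof (rule eq_if_eq_on_eigenvectors)
  fix j assume j: "j \<le> d"
  have "(\<Sum>i\<le>d. act (scaleA (poly p (\<theta> i)) (E i)) (eigenvector j)) =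
        (\<Sum>i\<le>d. if i = j then scaleV (poly p (\<theta> j)) (eigenvector j) else 0)"
    by (rule sum.cong) (use j in \<open>auto simp: act_scale act_idempotent_eigenvector\<close>)
  then show "act (alg_poly scaleA p A) (eigenvector j) =
      act (\<Sum>i\<le>d. scaleA (poly p (\<theta> i)) (E i)) (eigenvector j)"
    using j by (simp add: act_poly_eigenvector act_sum_left)
qed

lemma sum_idempotents: "(\<Sum>i\<le>d. E i) = 1"
  using alg_poly_expand[of 1] by simp

lemma alg_poly_mult_idempotent:
  assumes "i \<le> d"
  shows "alg_poly scaleA p A * E i = scaleA (poly p (\<theta> i)) (E i)"
  by (rule eq_if_eq_on_eigenvectors)
    (use assms in \<open>auto simp: act_mult act_scale act_idempotent_eigenvector act_poly_eigenvector\<close>)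

lemma alg_poly_node_poly:
  assumes "i \<le> d"
  shows "alg_poly scaleA (node_poly d \<theta> i) A = scaleA (node_product d \<theta> i) (E i)"
proof -
  have "alg_poly scaleA (node_poly d \<theta> i) A =
      (\<Sum>j\<le>d. if j = i then scaleA (node_product d \<theta> i) (E i) else 0)"
    unfolding alg_poly_expand by (rule sum.cong) (use assms in \<open>auto simp: poly_node_poly\<close>)
  then show ?thesis
    using assms by simp
qed

lemma act_idempotent_range:
  assumes "i \<le> d"
  shows "\<exists>c. act (E i) v = scaleV c (eigenvector i)"
proof -
  have "V.span (eigenvector ` {..d}) \<subseteq> {v. act (E i) v \<in> range (\<lambda>c. scaleV c (eigenvector i))}"
    (is "_ \<subseteq> ?S")
  proof (rule V.span_minimal)
    show "eigenvector ` {..d} \<subseteq> ?S"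
    proof
      fix v assume "v \<in> eigenvector ` {..d}"
      then have "act (E i) v = scaleV 1 (eigenvector i) \<or> act (E i) v = scaleV 0 (eigenvector i)"
        using assms by (auto simp: act_idempotent_eigenvector)
      then show "v \<in> ?S"
        by blast
    qed
    show "V.subspace ?S"
    proof (rule V.subspaceI)
      show "0 \<in> ?S"
        by (auto intro: range_eqI[of _ _ 0])
    next
      fix x y assume "x \<in> ?S" "y \<in> ?S"
      then show "x + y \<in> ?S"
        by (auto simp: act_add_right simp flip: V.scale_left_distrib)
    next
      fix a x assume "x \<in> ?S"
      then show "scaleV a x \<in> ?S"
        by (auto simp: act_scale_right)
    qed
  qed
  then show ?thesis
    by (auto simp: span_eigenvectors)
qed

lemma act_idempotent_spans:
  assumes "i \<le> d" "u \<in> range (act (E i))" "u \<noteq> 0"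
  shows "\<exists>c. act (E i) v = scaleV c u"
proof -
  obtain a where a: "u = scaleV a (eigenvector i)"
    using assms act_idempotent_range[OF assms(1)] by blast
  obtain c where "act (E i) v = scaleV c (eigenvector i)"
    using act_idempotent_range[OF assms(1)] by blast
  then have "act (E i) v = scaleV (c / a) u"
    using a assms(3) by auto
  then show ?thesis ..
qed

lemma act_idempotent_fixes:
  "i \<le> d \<Longrightarrow> u \<in> range (act (E i)) \<Longrightarrow> act (E i) u = u"
  by (auto simp: idempotent_mult simp flip: act_mult)

text \<open>Since \<open>E\<^sub>i\<close> has a one-dimensional image, a vector of that image reached through \<open>y\<close> is as good as
  any other for testing whether \<open>x\<close> annihilates the image. This allows a product to be shown nonzero
  by cutting it at a rank one factor.\<close>

lemma rank_one_nonzero: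
  assumes i: "i \<le> d" and x: "x * E i \<noteq> 0" and y: "E i * y \<noteq> 0"
  shows "x * E i * y \<noteq> 0"
proof -
  obtain v where v: "act (E i) (act y v) \<noteq> 0"
    using y by (auto simp: nonzero_iff_act act_mult)
  obtain u where u: "act x (act (E i) u) \<noteq> 0"
    using x by (auto simp: nonzero_iff_act act_mult)
  obtain c where "act (E i) u = scaleV c (act (E i) (act y v))"
    using act_idempotent_spans[OF i _ v] by blast
  with u have "act (x * E i * y) v \<noteq> 0"
    by (auto simp: act_mult act_scale_right)
  then show ?thesis
    by auto
qed

lemma idempotent_trace:
  assumes "i \<le> d"
  shows "E i * x * E i = scaleA (alg_trace rep (E i * x)) (E i)"
proof -
  let ?w = "eigenvector i"
  have range: "\<exists>c. act (E i * x) u = scaleV c ?w" for u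
    using act_idempotent_range[OF assms] by (simp add: act_mult)
  then obtain t where t: "act (E i * x) ?w = scaleV t ?w"
    by blast
  have "alg_trace rep (E i * x) = t"
    by (rule alg_trace_rank_one[OF range t]) (simp add: assms eigenvector)
  with t show ?thesis
    by (intro eq_if_eq_on_eigenvectors)
      (use assms in \<open>auto simp: act_mult act_scale act_idempotent_eigenvector\<close>)
qed

lemma idempotent_nonzero: "i \<le> d \<Longrightarrow> E i \<noteq> 0"
  using act_idempotent_eigenvector[of i i] eigenvector(1)[of i] by auto

lemma alg_trace_idempotent: "i \<le> d \<Longrightarrow> alg_trace rep (E i) = 1"
  using idempotent_trace[of i 1] idempotent_nonzero[of i]
  by (simp add: idempotent_mult) (metis scale_cancel_right scale_one)

text \<open>The left radical of an invariant form is a submodule, hence zero. As \<open>E\<^sub>i\<close> is self-adjoint, the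
  pairing of \<open>u \<in> E\<^sub>iV\<close> with any vector only sees the component of that vector in the line of \<open>u\<close>;
  so nondegeneracy forces \<open>\<langle>u, u\<rangle> \<noteq> 0\<close>, and \<open>E\<^sub>i\<close> is the orthogonal projection onto \<open>u\<close>.\<close>

lemma form_projection:
  assumes i: "i \<le> d" and u: "u \<in> range (act (E i))" "u \<noteq> 0"
    and form: "bilinear_form scaleV b" "\<exists>u v. b u v \<noteq> 0"
    and adjoint: "\<And>x u v. b (act x u) v = b u (act (dag x) v)"
    and dag: "antiautomorphism scaleA dag" "dag A = A"
  shows "b u u \<noteq> 0" "act (E i) v = scaleV (b v u / b u u) u"
proof -
  interpret left: Vector_Spaces.linear scaleV "(*)" "\<lambda>x. b x y" for y
    using form by (simp add: bilinear_form_def)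
  interpret right: Vector_Spaces.linear scaleV "(*)" "b x" for x
    using form by (simp add: bilinear_form_def)
  have dag_E: "dag (E i) = E i"
    using idempotent_as_poly[OF i] antiautomorphism_alg_poly[OF dag(1), of _ A] dag(2) by metis
  define R where "R = {x. \<forall>v. b x v = 0}"
  have "R = {0} \<or> R = UNIV"
  proof (rule irreducible)
    show "V.subspace R"
      by (rule V.subspaceI) (simp_all add: R_def left.zero left.add left.scale)
  qed (simp add: R_def adjoint)
  moreover have "R \<noteq> UNIV"
    using form(2) by (auto simp: R_def)
  ultimately have "R = {0}"
    by blast
  with u(2) have "u \<notin> R"
    by simp
  then obtain v' where v': "b u v' \<noteq> 0"
    by (auto simp: R_def)
  obtain c where "act (E i) v' = scaleV c u"
    using act_idempotent_spans[OF i u] by blast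
  then have "b u v' = c * b u u"
    using adjoint[of "E i" u v'] by (simp add: dag_E act_idempotent_fixes[OF i u(1)] right.scale)
  with v' show nz: "b u u \<noteq> 0"
    by auto
  obtain a where a: "act (E i) v = scaleV a u"
    using act_idempotent_spans[OF i u] by blast
  then have "b v u = a * b u u"
    using adjoint[of "E i" v u] by (simp add: dag_E act_idempotent_fixes[OF i u(1)] left.scale)
  with a nz show "act (E i) v = scaleV (b v u / b u u) u"
    by simp
qed

end

section \<open>Powers of an irreducible tridiagonal element\<close>

locale tridiagonal_action = multiplicity_free_element scaleA d rep scaleV act A E \<theta>
  for scaleA :: "'k::field \<Rightarrow> 'a::ring_1 \<Rightarrow> 'a"
    and d :: nat
    and rep :: "'a \<Rightarrow> 'k mat"
    and scaleV :: "'k \<Rightarrow> 'v::ab_group_add \<Rightarrow> 'v"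
    and act :: "'a \<Rightarrow> 'v \<Rightarrow> 'v"
    and A :: 'a and E :: "nat \<Rightarrow> 'a" and \<theta> :: "nat \<Rightarrow> 'k" +
  fixes B :: 'a
  assumes tridiagonal:
    "\<forall>i\<le>d. \<forall>j\<le>d.
       (\<bar>int i - int j\<bar> > 1 \<longrightarrow> E i * B * E j = 0) \<and>
       (\<bar>int i - int j\<bar> = 1 \<longrightarrow> E i * B * E j \<noteq> 0)"
begin

lemma idempotent_power_Suc:
  "E j * B ^ Suc k * E i = (\<Sum>l\<le>d. (E j * B * E l) * (E l * B ^ k * E i))"
proof -
  have "E j * B ^ Suc k * E i = E j * B * (\<Sum>l\<le>d. E l) * (B ^ k * E i)"
    by (simp add: sum_idempotents mult.assoc)
  also have "\<dots> = (\<Sum>l\<le>d. E j * B * E l * (B ^ k * E i))"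
    by (simp only: sum_distrib_left sum_distrib_right)
  also have "\<dots> = (\<Sum>l\<le>d. (E j * B * E l) * (E l * B ^ k * E i))"
  proof (rule sum.cong)
    fix l assume "l \<in> {..d}"
    then have "E l * (E l * (B ^ k * E i)) = E l * (B ^ k * E i)"
      using idempotent_mult[of l l] by (simp flip: mult.assoc)
    then show "E j * B * E l * (B ^ k * E i) = E j * B * E l * (E l * B ^ k * E i)"
      by (simp add: mult.assoc)
  qed simp
  finally show ?thesis .
qed

text \<open>Each factor \<open>B\<close> moves the index of the eigenspace by at most one, so an index distance \<open>k\<close> needs
  \<open>k\<close> factors; with exactly \<open>k\<close> factors there is a single path, all of whose steps are nonzero.\<close>

lemma power_far:
  assumes "i \<le> d" "j \<le> d" "i + k < j \<or> j + k < i"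
  shows "E j * B ^ k * E i = 0"
  using assms(2,3)
proof (induction k arbitrary: j)
  case 0
  then show ?case
    using assms(1) by (auto simp: idempotent_mult)
next
  case (Suc k)
  show ?case
    unfolding idempotent_power_Suc
  proof (rule sum.neutral, rule ballI)
    fix l assume l: "l \<in> {..d}"
    show "(E j * B * E l) * (E l * B ^ k * E i) = 0"
    proof (cases "i + k < l \<or> l + k < i")
      case True
      with Suc.IH[of l] l show ?thesis
        by simp
    next
      case False
      with Suc.prems have "\<bar>int j - int l\<bar> > 1"
        by auto
      with tridiagonal Suc.prems l have "E j * B * E l = 0"
        by auto
      then show ?thesis
        by simp
    qed
  qed
qed

lemma power_edge:
  assumes "i \<le> d" "j \<le> d" "j = i + k \<or> i = j + k"
  shows "E j * B ^ k * E i \<noteq> 0"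
  using assms(2,3)
proof (induction k arbitrary: j)
  case 0
  then show ?case
    using assms(1) by (auto simp: idempotent_mult idempotent_nonzero)
next
  case (Suc k)
  define m where "m = (if j = i + Suc k then i + k else j + 1)"
  have m: "m \<le> d" "m = i + k \<or> i = m + k" "\<bar>int j - int m\<bar> = 1"
    using Suc.prems assms(1) by (auto simp: m_def)
  have "(E j * B * E l) * (E l * B ^ k * E i) = 0" if l: "l \<in> {..d} - {m}" for l
  proof (cases "i + k < l \<or> l + k < i")
    case True
    with power_far[of i l k] l assms(1) show ?thesis
      by simp
  next
    case False
    with Suc.prems l have "\<bar>int j - int l\<bar> > 1"
      by (auto simp: m_def split: if_splits)
    with tridiagonal Suc.prems l have "E j * B * E l = 0"
      by auto
    then show ?thesis
      by simp
  qed
  then have "E j * B ^ Suc k * E i = (\<Sum>l\<in>{m}. (E j * B * E l) * (E l * B ^ k * E i))"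
    unfolding idempotent_power_Suc using m by (intro sum.mono_neutral_right) auto
  also have "\<dots> = E j * B * E m * (B ^ k * E i)"
    using m idempotent_mult[of m m] by (simp add: mult.assoc) (simp flip: mult.assoc)
  also have "\<dots> \<noteq> 0"
  proof (rule rank_one_nonzero)
    show "E j * B * E m \<noteq> 0"
      using tridiagonal Suc.prems(1) m by auto
    show "E m * (B ^ k * E i) \<noteq> 0"
      using Suc.IH[OF m(1,2)] by (simp add: mult.assoc)
  qed (rule m)
  finally show ?case .
qed

text \<open>On eigenspaces at distance at least the degree, the lower order terms of a polynomial in \<open>B\<close> do
  not contribute.\<close>

lemma alg_poly_edge:
  assumes "i \<le> d" "j \<le> d" "i + degree p \<le> j \<or> j + degree p \<le> i"
  shows "E j * alg_poly scaleA p B * E i = scaleA (lead_coeff p) (E j * B ^ degree p * E i)"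
proof -
  have "E j * alg_poly scaleA p B * E i =
      (\<Sum>k\<le>degree p. scaleA (poly.coeff p k) (E j * B ^ k * E i))"
    by (simp add: alg_poly_def sum_distrib_left sum_distrib_right scale_mult_left scale_mult_right)
  also have "\<dots> = (\<Sum>k\<in>{degree p}. scaleA (poly.coeff p k) (E j * B ^ k * E i))"
  proof (rule sum.mono_neutral_right)
    show "\<forall>k\<in>{..degree p} - {degree p}. scaleA (poly.coeff p k) (E j * B ^ k * E i) = 0"
    proof
      fix k assume "k \<in> {..degree p} - {degree p}"
      then have "E j * B ^ k * E i = 0"
        using assms by (intro power_far) auto
      then show "scaleA (poly.coeff p k) (E j * B ^ k * E i) = 0"
        by simp
    qed
  qed auto
  finally show ?thesis
    by simp
qed

text \<open>All monic polynomials of degree \<open>d\<close> have the same corner entry. With the nodes taken to be the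
  eigenvalues of \<open>B\<close>, these polynomials become multiples of the primitive idempotents of \<open>B\<close>, and
  this is how different idempotents get compared.\<close>

lemma node_poly_corner:
  assumes "r \<le> d" "i = 0 \<and> j = d \<or> i = d \<and> j = 0"
  shows "E j * alg_poly scaleA (node_poly d \<theta>' r) B * E i = E j * B ^ d * E i"
  using alg_poly_edge[of i j "node_poly d \<theta>' r"] lead_coeff_node_poly[of d \<theta>' r] assms
  by (auto simp: degree_node_poly)

end

section \<open>Leonard pairs\<close>

locale leonard_pair =
  a: tridiagonal_action scaleA d rep scaleV act A E \<theta> As +
  as: tridiagonal_action scaleA d rep scaleV act As Es \<theta>s A
  for scaleA :: "'k::field \<Rightarrow> 'a::ring_1 \<Rightarrow> 'a"
    and d :: nat
    and rep :: "'a \<Rightarrow> 'k mat"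
    and scaleV :: "'k \<Rightarrow> 'v::ab_group_add \<Rightarrow> 'v"
    and act :: "'a \<Rightarrow> 'v \<Rightarrow> 'v"
    and A :: 'a and E :: "nat \<Rightarrow> 'a" and \<theta> :: "nat \<Rightarrow> 'k"
    and As :: 'a and Es :: "nat \<Rightarrow> 'a" and \<theta>s :: "nat \<Rightarrow> 'k"
begin

lemma swap: "leonard_pair scaleA d rep scaleV act As Es \<theta>s A E \<theta>"
  by unfold_locales

text \<open>The key identity: up to the explicit factor \<open>\<Prod>\<^sub>j\<^sub>\<noteq>\<^sub>r (\<theta>\<^sup>*\<^sub>r - \<theta>\<^sup>*\<^sub>j)\<close>, the element \<open>E\<^sub>d E\<^sup>*\<^sub>r E\<^sub>0\<close> does not
  depend on \<open>r\<close>, because every \<open>r\<close> gives the corner entry of a monic polynomial of degree \<open>d\<close> in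
  \<open>A\<^sup>*\<close>. The opposite corner, with \<open>E\<^sub>0\<close> and \<open>E\<^sub>d\<close> exchanged, behaves in the same way.\<close>

lemma corner:
  assumes "r \<le> d" "i = 0 \<and> j = d \<or> i = d \<and> j = 0"
  shows "scaleA (node_product d \<theta>s r) (E j * Es r * E i) = E j * As ^ d * E i"
  using a.node_poly_corner[OF assms, of \<theta>s] assms(1)
  by (simp add: as.alg_poly_node_poly a.scale_mult_left a.scale_mult_right)

lemma corner_nonzero:
  assumes "r \<le> d" "i = 0 \<and> j = d \<or> i = d \<and> j = 0"
  shows "E j * Es r * E i \<noteq> 0"
proof -
  have "E j * As ^ d * E i \<noteq> 0"
    using assms(2) by (intro a.power_edge) auto
  with corner[OF assms] show ?thesis
    by auto
qed

lemma end_mult_nonzero: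
  assumes "r \<le> d"
  shows "Es r * E 0 \<noteq> 0" "Es r * E d \<noteq> 0" "E 0 * Es r \<noteq> 0" "E d * Es r \<noteq> 0"
  using corner_nonzero[OF assms, of 0 d] corner_nonzero[OF assms, of d 0]
  by (metis mult.assoc mult_zero_left mult_zero_right)+

lemma trace_nonzero:
  assumes "r \<le> d" "i = 0 \<or> i = d"
  shows "alg_trace rep (Es r * E i) \<noteq> 0"
proof -
  have "E i * Es r * E i \<noteq> 0"
    using as.rank_one_nonzero[OF assms(1)] end_mult_nonzero[OF assms(1)] assms(2) by blast
  then show ?thesis
    using a.idempotent_trace[of i "Es r"] assms(2) by (auto simp: a.alg_trace_commute)
qed

text \<open>The denominators in the definition of the second split sequence do not vanish. The element
  \<open>\<eta>\<^sub>i(A) E\<^sup>*\<^sub>0\<close> lies in the sum of the dual eigenspaces \<open>0, \<dots>, i\<close>, and its component in the dual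
  eigenspace \<open>0\<close> is governed by the trace in question. If this trace were zero, the polynomial \<open>\<pi>\<close> with
  roots \<open>\<theta>\<^sup>*\<^sub>1, \<dots>, \<theta>\<^sup>*\<^sub>i\<close> would annihilate the element. On the other hand, the element has a nonzero
  component in the eigenspace \<open>d - i\<close> of \<open>A\<close> and none in the eigenspaces above it, and \<open>\<pi>(A\<^sup>*)\<close>, of
  degree \<open>i\<close>, moves this component to a nonzero component in the eigenspace \<open>d\<close>.\<close>

lemma eta_trace_nonzero:
  assumes i: "i \<le> d"
  shows "alg_trace rep (alg_poly scaleA (eta d \<theta> i) A * Es 0) \<noteq> 0"
proof
  let ?X = "alg_poly scaleA (eta d \<theta> i) A"
  define \<pi> where "\<pi> = (\<Prod>j\<in>{1..i}. [:- \<theta>s j, 1:])"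
  let ?P = "alg_poly scaleA \<pi> As"
  have lead_\<pi>: "lead_coeff \<pi> = 1" and degree_\<pi>: "degree \<pi> = i"
    unfolding \<pi>_def by (simp only: lead_coeff_prod_linear) (simp add: degree_prod_linear)
  have degree_eta: "degree (eta d \<theta> i) = i"
    by (simp add: eta_def degree_prod_linear)
  assume "alg_trace rep (?X * Es 0) = 0"
  then have X_0: "Es 0 * ?X * Es 0 = 0"
    using as.idempotent_trace[of 0 ?X] by (simp add: a.alg_trace_commute)
  \<comment> \<open>The component \<open>0\<close> vanishes by assumption, \<open>1, \<dots>, i\<close> through \<open>\<pi>\<close>, and the rest for degree reasons.\<close>
  have "?P * Es l * ?X * Es 0 = 0" if l: "l \<le> d" for l
  proof -
    consider "l = 0" | "1 \<le> l" "l \<le> i" | "i < l"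
      by linarith
    then show ?thesis
    proof cases
      case 1
      then show ?thesis
        using X_0 by (simp add: mult.assoc)
    next
      case 2
      then have "poly \<pi> (\<theta>s l) = 0"
        by (auto simp: \<pi>_def poly_prod)
      then show ?thesis
        using as.alg_poly_mult_idempotent[OF l, of \<pi>] by simp
    next
      case 3
      then have "Es l * ?X * Es 0 = 0"
        using as.alg_poly_edge[of 0 l "eta d \<theta> i"] as.power_far[of 0 l i] l
        by (simp add: degree_eta)
      then show ?thesis
        by (simp add: mult.assoc)
    qed
  qed
  then have "?P * (\<Sum>l\<le>d. Es l) * ?X * Es 0 = 0"
    by (simp add: sum_distrib_left sum_distrib_right)
  then have zero: "?P * ?X * Es 0 = 0"
    by (simp add: as.sum_idempotents)
  \<comment> \<open>Above \<open>d - i\<close> the polynomial \<open>\<eta>\<^sub>i\<close> has a root, below it the degree of \<open>\<pi>\<close> is too small to reach \<open>d\<close>.\<close>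
  have X_E: "E d * ?P * (?X * E l) = 0" if "l \<le> d" "l \<noteq> d - i" for l
  proof (cases "l < d - i")
    case True
    then have "l + i < d"
      by linarith
    then have "E d * ?P * E l = 0"
      using a.alg_poly_edge[of l d \<pi>] a.power_far[of l d i] that
      by (simp add: degree_\<pi>)
    then show ?thesis
      using that by (simp add: a.alg_poly_mult_idempotent a.scale_mult_right)
  next
    case False
    with that i have "poly (eta d \<theta> i) (\<theta> l) = 0"
      by (auto simp: eta_eq_prod poly_prod)
    then show ?thesis
      using that by (simp add: a.alg_poly_mult_idempotent)
  qed
  have "0 = E d * ?P * ?X * (\<Sum>l\<le>d. E l) * Es 0"
    using zero by (simp add: a.sum_idempotents mult.assoc)
  also have "\<dots> = (\<Sum>l\<le>d. E d * ?P * (?X * E l) * Es 0)"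
    by (simp add: sum_distrib_left sum_distrib_right mult.assoc)
  also have "\<dots> = (\<Sum>l\<in>{d - i}. E d * ?P * (?X * E l) * Es 0)"
    using X_E by (intro sum.mono_neutral_right) auto
  also have "\<dots> = scaleA (poly (eta d \<theta> i) (\<theta> (d - i))) (E d * ?P * E (d - i) * Es 0)"
    by (simp add: a.alg_poly_mult_idempotent a.scale_mult_right a.scale_mult_left)
  finally have "poly (eta d \<theta> i) (\<theta> (d - i)) = 0 \<or> E d * ?P * E (d - i) * Es 0 = 0"
    by simp
  moreover have "poly (eta d \<theta> i) (\<theta> (d - i)) \<noteq> 0"
    using i by (auto simp: eta_eq_prod poly_prod a.eigenvalues_distinct)
  moreover have "E d * ?P * E (d - i) * Es 0 \<noteq> 0"
  proof (rule a.rank_one_nonzero)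
    interpret swap: leonard_pair scaleA d rep scaleV act As Es \<theta>s A E \<theta>
      by (rule swap)
    show "E (d - i) * Es 0 \<noteq> 0"
      by (rule swap.end_mult_nonzero) simp
    have "E d * ?P * E (d - i) = E d * As ^ i * E (d - i)"
      using a.alg_poly_edge[of "d - i" d \<pi>] i lead_\<pi> by (simp add: degree_\<pi>)
    also have "\<dots> \<noteq> 0"
      by (rule a.power_edge) (use i in auto)
    finally show "E d * ?P * E (d - i) \<noteq> 0" .
  qed simp
  ultimately show False
    by blast
qed

text \<open>The scalar by which \<open>E\<^sup>*\<^sub>d E\<^sub>0 E\<^sup>*\<^sub>0 E\<^sub>0\<close> is a multiple of \<open>E\<^sup>*\<^sub>d E\<^sub>0\<close> is computed twice: by collapsing
  \<open>E\<^sub>0 E\<^sup>*\<^sub>0 E\<^sub>0\<close>, and by replacing first \<open>E\<^sub>0\<close> with \<open>E\<^sub>d\<close> and then \<open>E\<^sup>*\<^sub>0\<close> with \<open>E\<^sup>*\<^sub>d\<close> through the two dual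
  forms of the corner identity.\<close>

lemma end_traces:
  "node_product d \<theta> 0 * node_product d \<theta>s 0 * alg_trace rep (E 0 * Es 0) =
   node_product d \<theta> d * node_product d \<theta>s d * alg_trace rep (E d * Es d)"
  (is "?c0 * ?cs0 * ?t0 = ?cd * ?csd * ?td")
proof -
  interpret swap: leonard_pair scaleA d rep scaleV act As Es \<theta>s A E \<theta>
    by (rule swap)
  have 1: "scaleA ?cs0 (E d * Es 0 * E 0) = scaleA ?csd (E d * Es d * E 0)"
    by (simp add: corner)
  have 2: "scaleA ?c0 (Es d * E 0 * Es 0) = scaleA ?cd (Es d * E d * Es 0)"
    by (simp add: swap.corner)
  have E0: "E 0 * Es 0 * E 0 = scaleA ?t0 (E 0)" and Ed: "E d * Es d * E d = scaleA ?td (E d)"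
    by (simp_all add: a.idempotent_trace)
  have Esd: "Es d * E d * Es d = scaleA ?td (Es d)"
    by (simp add: as.idempotent_trace a.alg_trace_commute)
  have "scaleA (?c0 * ?cs0 * ?t0) (Es d * E 0) = scaleA (?c0 * ?cs0) (Es d * (E 0 * Es 0 * E 0))"
    by (simp add: E0 a.scale_mult_right)
  also have "\<dots> = scaleA ?cs0 (scaleA ?c0 (Es d * E 0 * Es 0) * E 0)"
    by (simp add: a.scale_mult_left mult.assoc mult.commute)
  also have "\<dots> = scaleA ?cd (Es d * scaleA ?cs0 (E d * Es 0 * E 0))"
    unfolding 2 by (simp add: a.scale_mult_left a.scale_mult_right mult.assoc mult.commute)
  also have "\<dots> = scaleA (?cd * ?csd) ((Es d * E d * Es d) * E 0)"
    unfolding 1 by (simp add: a.scale_mult_right mult.assoc)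
  also have "\<dots> = scaleA (?cd * ?csd * ?td) (Es d * E 0)"
    by (simp add: Esd a.scale_mult_left)
  finally show ?thesis
    using end_mult_nonzero[of d] by simp
qed

text \<open>The product of the \<open>\<phi>\<^sub>k\<close> telescopes to an expression in \<open>tr(E\<^sub>0 E\<^sup>*\<^sub>0)\<close>, since \<open>\<eta>\<^sub>d(A)\<close> is a multiple of
  \<open>E\<^sub>0\<close>; the comparison of the traces at both ends turns it into one in \<open>tr(E\<^sub>d E\<^sup>*\<^sub>d)\<close>, the number that
  appears when \<open>\<xi>\<^sub>d\<close> is projected to \<open>E\<^sup>*\<^sub>dV\<close> and back.\<close>

lemma prod_split_sequence:
  assumes "\<forall>i\<in>{1..d}. phi i = (\<theta>s 0 - \<theta>s i) *
      (alg_trace rep (alg_poly scaleA (eta d \<theta> i) A * Es 0) /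
       alg_trace rep (alg_poly scaleA (eta d \<theta> (i - 1)) A * Es 0))"
  shows "(\<Prod>k=1..d. phi k) = node_product d \<theta> d * node_product d \<theta>s d * alg_trace rep (E d * Es d)"
proof -
  define t where "t i = alg_trace rep (alg_poly scaleA (eta d \<theta> i) A * Es 0)" for i
  have t_nonzero: "t i \<noteq> 0" if "i \<le> d" for i
    using eta_trace_nonzero[OF that] by (simp add: t_def)
  have t_0: "t 0 = 1"
    by (simp add: t_def eta_def as.alg_trace_idempotent)
  have t_d: "t d = node_product d \<theta> 0 * alg_trace rep (E 0 * Es 0)"
    by (simp add: t_def eta_eq_node_poly a.alg_poly_node_poly a.scale_mult_left a.alg_trace_scale)
  have "(\<Prod>k=1..m. phi k) = (\<Prod>k=1..m. \<theta>s 0 - \<theta>s k) * t m" if "m \<le> d" for m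
    using that
  proof (induction m)
    case (Suc m)
    have "phi (Suc m) = (\<theta>s 0 - \<theta>s (Suc m)) * (t (Suc m) / t m)"
      using assms Suc.prems by (simp add: t_def)
    with Suc t_nonzero[of m] show ?case
      by simp
  qed (simp add: t_0)
  moreover have "(\<Prod>k=1..d. \<theta>s 0 - \<theta>s k) = node_product d \<theta>s 0"
    unfolding node_product_def by (rule prod.cong) auto
  ultimately show ?thesis
    using end_traces by (simp add: t_d mult.commute mult.left_commute)
qed

end

section \<open>The transition formulas\<close>

theorem theorem12p1:
  fixes d :: nat
    and scaleA :: "'k::field \<Rightarrow> 'a::ring_1 \<Rightarrow> 'a" (infixr "*\<^sub>A" 75)
    and rep :: "'a \<Rightarrow> 'k mat"
    and scaleV :: "'k \<Rightarrow> 'v::ab_group_add \<Rightarrow> 'v"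
    and act :: "'a \<Rightarrow> 'v \<Rightarrow> 'v"
    and A As :: 'a
    and E Es :: "nat \<Rightarrow> 'a"
    and \<theta> \<theta>s vphi phi :: "nat \<Rightarrow> 'k"
    and dag :: "'a \<Rightarrow> 'a"
    and b :: "'v \<Rightarrow> 'v \<Rightarrow> 'k"
    and \<xi>0 \<xi>d \<xi>s0 \<xi>sd :: 'v
  assumes "matrix_algebra scaleA d rep"
    and "irreducible_algebra_module scaleA scaleV act"
    and "leonard_system d scaleA scaleV act A E As Es"
    and "parameter_array d scaleA rep scaleV act A E As Es \<theta> \<theta>s vphi phi"
    and "antiautomorphism scaleA dag" and "dag A = A" and "dag As = As"
    and "bilinear_form scaleV b" and "\<exists>u v. b u v \<noteq> 0"
    and "\<And>x u v. b (act x u) v = b u (act (dag x) v)"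
    and "\<xi>0 \<in> range (act (E 0))" and "\<xi>0 \<noteq> 0"
    and "\<xi>d \<in> range (act (E d))" and "\<xi>d \<noteq> 0"
    and "\<xi>s0 \<in> range (act (Es 0))" and "\<xi>s0 \<noteq> 0"
    and "\<xi>sd \<in> range (act (Es d))" and "\<xi>sd \<noteq> 0"
  shows
    "(\<forall>X \<in> {E, \<lambda>i. E (d - i),
            \<lambda>i. alg_poly scaleA (tau \<theta> i) A, \<lambda>i. alg_poly scaleA (tau \<theta> (d - i)) A,
            \<lambda>i. alg_poly scaleA (eta d \<theta> i) A, \<lambda>i. alg_poly scaleA (eta d \<theta> (d - i)) A}.
      \<forall>i\<le>d.
        act ((b \<xi>s0 \<xi>s0 / b \<xi>0 \<xi>s0) *\<^sub>A
              (\<Sum>r\<le>d. (1 / alg_trace rep (Es r * E 0)) *\<^sub>A (X r * Es 0 * E 0 * Es r)))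
            (act (Es i) \<xi>0) = act (X i) \<xi>s0 \<and>
        act ((b \<xi>sd \<xi>sd / b \<xi>0 \<xi>sd) *\<^sub>A
              (\<Sum>r\<le>d. (1 / alg_trace rep (Es r * E 0)) *\<^sub>A (X r * Es d * E 0 * Es r)))
            (act (Es i) \<xi>0) = act (X i) \<xi>sd \<and>
        act ((b \<xi>s0 \<xi>s0 / b \<xi>0 \<xi>s0) *\<^sub>A
              (\<Sum>r\<le>d. (1 / alg_trace rep (Es r * E 0)) *\<^sub>A (X (d - r) * Es 0 * E 0 * Es r)))
            (act (Es (d - i)) \<xi>0) = act (X i) \<xi>s0 \<and>
        act ((b \<xi>sd \<xi>sd / b \<xi>0 \<xi>sd) *\<^sub>A
              (\<Sum>r\<le>d. (1 / alg_trace rep (Es r * E 0)) *\<^sub>A (X (d - r) * Es d * E 0 * Es r)))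
            (act (Es (d - i)) \<xi>0) = act (X i) \<xi>sd) \<and>
     (\<forall>X \<in> {Es, \<lambda>i. Es (d - i),
            \<lambda>i. alg_poly scaleA (tau \<theta>s i) As, \<lambda>i. alg_poly scaleA (tau \<theta>s (d - i)) As,
            \<lambda>i. alg_poly scaleA (eta d \<theta>s i) As, \<lambda>i. alg_poly scaleA (eta d \<theta>s (d - i)) As}.
      \<forall>i\<le>d.
        act (\<Sum>r\<le>d. (1 / alg_trace rep (Es r * E 0)) *\<^sub>A (X r * E 0 * Es r))
            (act (Es i) \<xi>0) = act (X i) \<xi>0 \<and>
        act ((poly (tau \<theta> d) (\<theta> d) / (\<Prod>k=1..d. phi k) * (b \<xi>d \<xi>sd / b \<xi>0 \<xi>sd)) *\<^sub>A
              (\<Sum>r\<le>d. (poly (tau \<theta>s r) (\<theta>s r) * poly (eta d \<theta>s (d - r)) (\<theta>s r)) *\<^sub>A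
                 (X r * E d * Es r)))
            (act (Es i) \<xi>0) = act (X i) \<xi>d \<and>
        act (\<Sum>r\<le>d. (1 / alg_trace rep (Es r * E 0)) *\<^sub>A (X (d - r) * E 0 * Es r))
            (act (Es (d - i)) \<xi>0) = act (X i) \<xi>0 \<and>
        act ((poly (tau \<theta> d) (\<theta> d) / (\<Prod>k=1..d. phi k) * (b \<xi>d \<xi>sd / b \<xi>0 \<xi>sd)) *\<^sub>A
              (\<Sum>r\<le>d. (poly (tau \<theta>s r) (\<theta>s r) * poly (eta d \<theta>s (d - r)) (\<theta>s r)) *\<^sub>A
                 (X (d - r) * E d * Es r)))
            (act (Es (d - i)) \<xi>0) = act (X i) \<xi>d)"
proof -
  interpret matrix_module scaleA d rep scaleV act
    using assms(1,2) by (intro matrix_module.intro)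
  have idem: "idempotents_with_eigenvalues d scaleA scaleV act A E \<theta>"
    "idempotents_with_eigenvalues d scaleA scaleV act As Es \<theta>s"
    and phi: "\<forall>i\<in>{1..d}. phi i = (\<theta>s 0 - \<theta>s i) *
      (alg_trace rep (alg_poly scaleA (eta d \<theta> i) A * Es 0) /
       alg_trace rep (alg_poly scaleA (eta d \<theta> (i - 1)) A * Es 0))"
    using assms(4) unfolding parameter_array_def by blast+
  interpret leonard_pair scaleA d rep scaleV act A E \<theta> As Es \<theta>s
    using assms(3) idem unfolding leonard_system_def
    by unfold_locales blast+
  note form = assms(8-10) assms(5)
  have E0_fix: "act (E 0) \<xi>0 = \<xi>0"
    using a.act_idempotent_fixes assms(11) by blast
  \<comment> \<open>Each summand other than the one with index \<open>i\<close> annihilates \<open>E\<^sup>*\<^sub>i \<xi>\<^sub>0\<close>.\<close>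
  have collapse: "act (\<Sum>r\<le>d. c r *\<^sub>A (Y r * Es r)) (act (Es i) \<xi>0) =
      scaleV (c i) (act (Y i) (act (Es i) \<xi>0))" if "i \<le> d" for c Y i
  proof -
    have "act (Y r * Es r) (act (Es i) \<xi>0) = (if r = i then act (Y i) (act (Es i) \<xi>0) else 0)"
      if "r \<le> d" for r
    proof -
      have "Y r * Es r * Es i = (if r = i then Y i * Es i else 0)"
        using that \<open>i \<le> d\<close> as.idempotent_mult[of r i] by (auto simp: mult.assoc)
      then show ?thesis
        by (simp flip: act_mult)
    qed
    then have "act (\<Sum>r\<le>d. c r *\<^sub>A (Y r * Es r)) (act (Es i) \<xi>0) =
        (\<Sum>r\<le>d. if r = i then scaleV (c i) (act (Y i) (act (Es i) \<xi>0)) else 0)"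
      unfolding act_sum_left by (intro sum.cong) (auto simp: act_scale)
    then show ?thesis
      using that by simp
  qed
  have E0_Es: "act (E 0) (act (Es i) \<xi>0) = scaleV (alg_trace rep (Es i * E 0)) \<xi>0" for i
  proof -
    have "act (E 0) (act (Es i) \<xi>0) = act (E 0 * Es i * E 0) \<xi>0"
      by (simp add: act_mult E0_fix)
    then show ?thesis
      by (simp add: a.idempotent_trace act_scale E0_fix alg_trace_commute)
  qed
  have traces: "alg_trace rep (Es i * E 0) \<noteq> 0" if "i \<le> d" for i
    using trace_nonzero[OF that] by simp
  have Es_\<xi>0: "act (Es l) \<xi>0 \<noteq> 0" if "l \<le> d" for l
  proof
    assume "act (Es l) \<xi>0 = 0"
    then have "scaleV (alg_trace rep (Es l * E 0)) \<xi>0 = 0"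
      using E0_Es[of l] by simp
    with traces[OF that] assms(12) show False
      by simp
  qed
  \<comment> \<open>The projections \<open>E\<^sub>0\<close> and \<open>E\<^sup>*\<^sub>l\<close> contribute \<open>tr(E\<^sup>*\<^sub>iE\<^sub>0)\<close> and \<open>\<langle>\<xi>\<^sub>0, x\<rangle> / \<langle>x, x\<rangle>\<close>; the prefactors cancel them.\<close>
  have end_vector: "scaleV (b x x / b \<xi>0 x * (1 / alg_trace rep (Es i * E 0)))
        (act (Es l) (act (E 0) (act (Es i) \<xi>0))) = x" and pairing: "b \<xi>0 x \<noteq> 0"
    if "l \<le> d" "i \<le> d" "x \<in> range (act (Es l))" "x \<noteq> 0" for l i x
  proof -
    have "b x x \<noteq> 0" and proj: "act (Es l) \<xi>0 = scaleV (b \<xi>0 x / b x x) x"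
      using as.form_projection[OF that(1,3,4) form assms(7)] by blast+
    then show "b \<xi>0 x \<noteq> 0"
      using Es_\<xi>0[OF that(1)] by auto
    with \<open>b x x \<noteq> 0\<close> show "scaleV (b x x / b \<xi>0 x * (1 / alg_trace rep (Es i * E 0)))
        (act (Es l) (act (E 0) (act (Es i) \<xi>0))) = x"
      using traces[OF that(2)] by (simp add: E0_Es act_scale_right proj)
  qed
  define \<kappa> where "\<kappa> = poly (tau \<theta> d) (\<theta> d) / (\<Prod>k=1..d. phi k) * (b \<xi>d \<xi>sd / b \<xi>0 \<xi>sd)"
  \<comment> \<open>The corner identity moves \<open>E\<^sup>*\<^sub>i\<close> to \<open>E\<^sup>*\<^sub>d\<close>, where \<open>E\<^sup>*\<^sub>d \<xi>\<^sub>0\<close> and \<open>E\<^sup>*\<^sub>d \<xi>\<^sub>d\<close> are both multiples of \<open>\<xi>\<^sup>*\<^sub>d\<close>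
    in the ratio of their pairings with it.\<close>
  have last_vector: "scaleV (\<kappa> * (poly (tau \<theta>s i) (\<theta>s i) * poly (eta d \<theta>s (d - i)) (\<theta>s i)))
      (act (E d) (act (Es i) \<xi>0)) = \<xi>d" if "i \<le> d" for i
  proof -
    let ?cd = "node_product d \<theta> d" and ?csd = "node_product d \<theta>s d"
      and ?td = "alg_trace rep (E d * Es d)"
    let ?q = "b \<xi>sd \<xi>sd"
    have q: "?q \<noteq> 0" and proj: "act (Es d) v = scaleV (b v \<xi>sd / ?q) \<xi>sd" for v
      using as.form_projection[OF _ assms(17,18) form assms(7)] by blast+
    have pair: "b \<xi>0 \<xi>sd \<noteq> 0"
      using pairing[OF _ _ assms(17,18)] by blast
    have "scaleA (node_product d \<theta>s i) (E d * Es i * E 0) = scaleA ?csd (E d * Es d * E 0)"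
      by (simp add: corner that)
    then have "act (scaleA (node_product d \<theta>s i) (E d * Es i * E 0)) \<xi>0 =
        act (scaleA ?csd (E d * Es d * E 0)) \<xi>0"
      by simp
    then have to_last: "scaleV (node_product d \<theta>s i) (act (E d) (act (Es i) \<xi>0)) =
        scaleV ?csd (act (E d) (act (Es d) \<xi>0))"
      by (simp add: act_scale act_mult E0_fix)
    have "act (E d) (act (Es d) \<xi>d) = act (E d * Es d * E d) \<xi>d"
      using a.act_idempotent_fixes[OF _ assms(13)] by (simp add: act_mult)
    also have "\<dots> = scaleV ?td \<xi>d"
      using a.act_idempotent_fixes[OF _ assms(13)] by (simp add: a.idempotent_trace act_scale)
    finally have "scaleV (b \<xi>d \<xi>sd / ?q) (act (E d) \<xi>sd) = scaleV ?td \<xi>d"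
      by (simp add: proj act_scale_right)
    moreover have "scaleV (b \<xi>d \<xi>sd / b \<xi>0 \<xi>sd) (act (E d) (act (Es d) \<xi>0)) =
        scaleV (b \<xi>d \<xi>sd / ?q) (act (E d) \<xi>sd)"
      using pair by (simp add: proj act_scale_right)
    ultimately have ratio:
      "scaleV (b \<xi>d \<xi>sd / b \<xi>0 \<xi>sd) (act (E d) (act (Es d) \<xi>0)) = scaleV ?td \<xi>d"
      by simp
    have "scaleV (\<kappa> * node_product d \<theta>s i) (act (E d) (act (Es i) \<xi>0)) =
        scaleV \<kappa> (scaleV ?csd (act (E d) (act (Es d) \<xi>0)))"
      by (simp flip: to_last)
    also have "\<dots> = scaleV (?cd / (\<Prod>k=1..d. phi k) * ?csd)
        (scaleV (b \<xi>d \<xi>sd / b \<xi>0 \<xi>sd) (act (E d) (act (Es d) \<xi>0)))"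
      by (simp add: \<kappa>_def tau_eq_node_product ac_simps)
    also have "\<dots> = scaleV (?cd / (\<Prod>k=1..d. phi k) * ?csd * ?td) \<xi>d"
      by (simp add: ratio)
    also have "?cd / (\<Prod>k=1..d. phi k) * ?csd * ?td = 1"
      using prod_split_sequence[OF phi] a.node_product_nonzero[of d] as.node_product_nonzero[of d]
        trace_nonzero[of d d] by (simp add: alg_trace_commute)
    finally show ?thesis
      by (simp add: tau_eta_eq_node_product[OF that])
  qed
  have dual_end_transition: "act ((b x x / b \<xi>0 x) *\<^sub>A
        (\<Sum>r\<le>d. (1 / alg_trace rep (Es r * E 0)) *\<^sub>A (X r * Es l * E 0 * Es r)))
        (act (Es i) \<xi>0) = act (X i) x"
    if "i \<le> d" "l \<le> d" "x \<in> range (act (Es l))" "x \<noteq> 0" for X i l x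
    using end_vector[OF that(2,1,3,4)]
    by (simp add: act_scale collapse[OF that(1)] act_mult flip: act_scale_right)
  have first_transition: "act (\<Sum>r\<le>d. (1 / alg_trace rep (Es r * E 0)) *\<^sub>A (X r * E 0 * Es r))
        (act (Es i) \<xi>0) = act (X i) \<xi>0" if "i \<le> d" for X i
    using traces[OF that]
    by (simp add: collapse[OF that] act_mult E0_Es act_scale_right)
  have last_transition: "act (\<kappa> *\<^sub>A
        (\<Sum>r\<le>d. (poly (tau \<theta>s r) (\<theta>s r) * poly (eta d \<theta>s (d - r)) (\<theta>s r)) *\<^sub>A (X r * E d * Es r)))
        (act (Es i) \<xi>0) = act (X i) \<xi>d" if "i \<le> d" for X i
    using last_vector[OF that]
    by (simp add: act_scale collapse[OF that] act_mult flip: act_scale_right)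
  \<comment> \<open>The formulas with \<open>X\<^sub>d\<^sub>-\<^sub>r\<close> are those with \<open>X\<^sub>r\<close> for the reversed sequence at the index \<open>d - i\<close>.\<close>
  show ?thesis
    unfolding \<kappa>_def[symmetric]
    apply (intro conjI ballI allI impI)
    subgoal for X i using dual_end_transition[of i 0 \<xi>s0 X] assms(15,16) by simp
    subgoal for X i using dual_end_transition[of i d \<xi>sd X] assms(17,18) by simp
    subgoal for X i using dual_end_transition[of "d - i" 0 \<xi>s0 "\<lambda>i. X (d - i)"] assms(15,16) by simp
    subgoal for X i using dual_end_transition[of "d - i" d \<xi>sd "\<lambda>i. X (d - i)"] assms(17,18) by simp
    subgoal for X i by (rule first_transition)
    subgoal for X i by (rule last_transition)
    subgoal for X i using first_transition[of "d - i" "\<lambda>i. X (d - i)"] by simp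
    subgoal for X i using last_transition[of "d - i" "\<lambda>i. X (d - i)"] by simp
    done
qed

end
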